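(* Let $n\ge1$, $\mu\in\mathbb{R}^n$, let $\Sigma\in\mathbb{R}^{n\times n}$ be symmetric positive definite and $D=\Sigma^{-1}$. For $\theta>0$ let $$\mathcal{L}(\theta)=\frac{1}{\sqrt{(2\pi)^n\det(\Sigma)}}\int_{\mathbb{R}^n}\exp\Big\{-\theta\sum_{i=1}^n e^{\mu_i}e^{x_i}-\tfrac12x^\top Dx\Big\}\,dx ,$$ let $\widetilde{\mathcal{L}}(\theta)$ be its approximation defined in the context, and let $I(\theta)$ be the correction factor determined by $\mathcal{L}(\theta)=\widetilde{\mathcal{L}}(\theta)\,I(\theta)$. Then $$\lim_{\theta\to\infty}I(\theta)=1 .$$
   Context: $\mathcal{L}(\theta)=\mathbb{E}[e^{-\theta S_n}]$ is the Laplace transform of $S_n=e^{X_1}+\dots+e^{X_n}$ with $(X_1,\dots,X_n)\sim \mathrm{N}(\mu,\Sigma)$. For $\theta>0$ let $x^*=x^*(\theta)$ be the unique minimiser over $\mathbb{R}^n$ of $h_\theta(x)=\theta\sum_{i=1}^n e^{\mu_i+x_i}+\tfrac12x^\top Dx$, let $\Lambda=\Lambda(\theta)$ be the diagonal matrix with diagonal entries $\theta e^{\mu_i+x_i^*}$, $i=1,\dots,n$, let $\mathbf{1}=(1,\dots,1)^\top$ and let $\mathbf{I}$ be the $n\times n$ identity matrix. Then $$\widetilde{\mathcal{L}}(\theta)=\frac{1}{\sqrt{\det(\mathbf{I}+\Sigma\Lambda)}}\exp\Big\{\big(\mathbf{1}-\tfrac12x^*\big)^\top D\,x^*\Big\}.$$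 *)

theory Defs
  imports "HOL-Analysis.Analysis"
begin

definition symmetric_positive_definite :: "real ^ 'n ^ 'n \<Rightarrow> bool" where
  "symmetric_positive_definite A \<longleftrightarrow>
     transpose A = A \<and> (\<forall>x. x \<noteq> 0 \<longrightarrow> x \<bullet> (A *v x) > 0)"

definition laplace :: "real ^ 'n \<Rightarrow> real ^ 'n ^ 'n \<Rightarrow> real \<Rightarrow> real" where
  "laplace \<mu> \<Sigma> \<theta> =
     1 / sqrt ((2 * pi) ^ CARD('n) * det \<Sigma>) *
     (LINT x|lborel. exp (- \<theta> * (\<Sum>i\<in>UNIV. exp (\<mu> $ i) * exp (x $ i))
                          - 1 / 2 * (x \<bullet> (matrix_inv \<Sigma> *v x))))"

definition h :: "real ^ 'n \<Rightarrow> real ^ 'n ^ 'n \<Rightarrow> real \<Rightarrow> real ^ 'n \<Rightarrow> real" where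
  "h \<mu> \<Sigma> \<theta> x =
     \<theta> * (\<Sum>i\<in>UNIV. exp (\<mu> $ i + x $ i)) + 1 / 2 * (x \<bullet> (matrix_inv \<Sigma> *v x))"

text \<open>For positive definite \<open>\<Sigma>\<close> and \<open>\<theta> > 0\<close> the function \<open>h \<mu> \<Sigma> \<theta>\<close> is strictly convex and
  coercive, so the description below denotes its unique global minimiser. Outside that range
  the value is unspecified.\<close>

definition xstar :: "real ^ 'n \<Rightarrow> real ^ 'n ^ 'n \<Rightarrow> real \<Rightarrow> real ^ 'n" where
  "xstar \<mu> \<Sigma> \<theta> = (THE x. is_arg_min (h \<mu> \<Sigma> \<theta>) (\<lambda>_. True) x)"

definition Lam :: "real ^ 'n \<Rightarrow> real ^ 'n ^ 'n \<Rightarrow> real \<Rightarrow> real ^ 'n ^ 'n" where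
  "Lam \<mu> \<Sigma> \<theta> =
     (\<chi> i j. if i = j then \<theta> * exp (\<mu> $ i + xstar \<mu> \<Sigma> \<theta> $ i) else 0)"

definition laplace_approx :: "real ^ 'n \<Rightarrow> real ^ 'n ^ 'n \<Rightarrow> real \<Rightarrow> real" where
  "laplace_approx \<mu> \<Sigma> \<theta> =
     1 / sqrt (det (mat 1 + \<Sigma> ** Lam \<mu> \<Sigma> \<theta>)) *
     exp ((vec 1 - (1 / 2) *\<^sub>R xstar \<mu> \<Sigma> \<theta>) \<bullet> (matrix_inv \<Sigma> *v xstar \<mu> \<Sigma> \<theta>))"

end

theory Submission
  imports Defs "HOL-Probability.Distributions" "HOL-Real_Asymp.Real_Asymp"
begin

text \<open>
  Let \<open>D\<close> be the inverse of \<open>\<Sigma>\<close> and let \<open>\<lambda>\<^sub>i = \<theta> exp (\<mu>\<^sub>i + x\<^sup>*\<^sub>i)\<close> be the diagonal of \<open>\<Lambda>\<close>.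
  Stationarity of \<open>h\<close> at \<open>x\<^sup>*\<close> reads \<open>D x\<^sup>* = -\<lambda>\<close>. It cancels the linear terms of the expansion
  of \<open>h\<close> around \<open>x\<^sup>*\<close>, and the correction factor becomes
  \<open>I = sqrt (det (D + \<Lambda>)) / sqrt ((2\<pi>)^n) * \<integral> exp (- \<Sum>\<^sub>i \<lambda>\<^sub>i (e^u\<^sub>i - 1 - u\<^sub>i) - 1/2 u \<bullet> D u) du\<close>
  (\<open>laplace_eq_approx_mult_correction\<close>).

  Laplace's method handles a coordinate with \<open>\<lambda>\<^sub>i \<rightarrow> \<infinity>\<close>: it concentrates at \<open>0\<close>, where
  \<open>e^u - 1 - u\<close> may be replaced by \<open>u^2 / 2\<close>. If \<open>\<lambda>\<^sub>i \<rightarrow> 0\<close>, the non-quadratic term of that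
  coordinate disappears altogether. In both cases the limit is a Gaussian integral which the
  determinant normalises (\<open>laplace_integral_tendsto\<close>, \<open>gaussian_integral\<close>). The second case does
  occur: if \<open>D\<close> has a negative row sum, the \<open>\<lambda>\<^sub>i\<close> do not all tend to \<open>\<infinity>\<close>. A coordinate whose \<open>\<lambda>\<^sub>i\<close>
  stays at a finite positive level would be fatal, since then a truly non-Gaussian factor
  would survive in the limit.

  The heart of the proof is that this cannot happen (\<open>no_bounded_log_component\<close>).
  Eliminating \<open>x\<^sup>*\<close> gives \<open>(\<Sigma> \<lambda>)\<^sub>i + ln \<lambda>\<^sub>i = L + \<mu>\<^sub>i\<close> with \<open>L = ln \<theta>\<close>. Along a subsequence
  \<open>\<lambda> / L\<close> converges to some \<open>\<nu>\<close>. Where \<open>\<nu>\<^sub>i > 0\<close> one has \<open>ln \<lambda>\<^sub>i = ln L + O(1)\<close>; where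
  \<open>(\<Sigma> \<nu>)\<^sub>i > 1\<close> one has \<open>\<lambda>\<^sub>i \<rightarrow> 0\<close>; on the remaining indices, among them every one with
  bounded \<open>ln \<lambda>\<^sub>i\<close>, one has \<open>\<nu>\<^sub>i = 0\<close> and \<open>(\<Sigma> \<nu>)\<^sub>i = 1\<close>.
  Eliminating the first group by a Schur complement turns the equations of the remaining indices into a system of exactly the same form, with \<open>ln L\<close> in place
  of \<open>L\<close>. The index set shrinks strictly, so the argument repeats on the scales
  \<open>ln \<theta>, ln ln \<theta>, \<dots>\<close> until no index is left that could be bounded.

  Since the limits of the single \<open>\<lambda>\<^sub>i\<close> are only obtained along subsequences, the theorem follows by
  extracting from every sequence \<open>\<theta>\<^sub>k \<rightarrow> \<infinity>\<close> a subsequence along which \<open>I\<close> tends to \<open>1\<close>.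
\<close>

section \<open>Positive definite matrices\<close>

lemma spd_symmetric_form:
  assumes "symmetric_positive_definite A"
  shows "x \<bullet> (A *v y) = y \<bullet> (A *v x)"
proof -
  have "x \<bullet> (A *v y) = (x v* A) \<bullet> y" by (simp add: dot_lmul_matrix)
  also have "x v* A = transpose A *v x" by simp
  also have "transpose A = A" using assms by (simp add: symmetric_positive_definite_def)
  finally show ?thesis by (simp add: inner_commute)
qed

lemma spd_iff_form:
  "symmetric_positive_definite A \<longleftrightarrow>
     (\<forall>x y. x \<bullet> (A *v y) = y \<bullet> (A *v x)) \<and> (\<forall>x. x \<noteq> 0 \<longrightarrow> x \<bullet> (A *v x) > 0)"
proof -
  have "transpose A = A" if "\<forall>x y. x \<bullet> (A *v y) = y \<bullet> (A *v x)"
  proof -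
    have "A $ i $ j = A $ j $ i" for i j
      using that[rule_format, of "axis i 1" "axis j 1"]
      by (simp add: inner_axis inner_axis' matrix_vector_mul_component)
    then show ?thesis by (simp add: transpose_def vec_eq_iff)
  qed
  then show ?thesis
    using spd_symmetric_form by (auto simp: symmetric_positive_definite_def)
qed

text \<open>
  By homogeneity it suffices to bound the form on the unit sphere, which is compact.
\<close>
lemma spd_coercive:
  fixes A :: "real^'n^'n"
  assumes "symmetric_positive_definite A"
  obtains c where "c > 0" "\<And>x. c * (norm x)\<^sup>2 \<le> x \<bullet> (A *v x)"
proof -
  have "continuous_on (sphere 0 1) (\<lambda>x::real^'n. x \<bullet> (A *v x))"
    by (intro continuous_intros)
  moreover have "sphere (0::real^'n) 1 \<noteq> {}" by simp
  ultimately obtain y where y: "y \<in> sphere 0 1"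
    and min: "\<And>x. x \<in> sphere 0 1 \<Longrightarrow> y \<bullet> (A *v y) \<le> x \<bullet> (A *v x)"
    using continuous_attains_inf[of "sphere 0 1" "\<lambda>x::real^'n. x \<bullet> (A *v x)"] by auto
  show thesis
  proof
    have "y \<noteq> 0" using y by auto
    then show "y \<bullet> (A *v y) > 0" using assms by (simp add: symmetric_positive_definite_def)
    fix x :: "real^'n"
    show "y \<bullet> (A *v y) * (norm x)\<^sup>2 \<le> x \<bullet> (A *v x)"
    proof (cases "x = 0")
      case False
      define u where "u = (1 / norm x) *\<^sub>R x"
      have x: "x = norm x *\<^sub>R u" using False by (simp add: u_def)
      have "norm u = 1" using False by (simp add: u_def)
      then have "y \<bullet> (A *v y) \<le> u \<bullet> (A *v u)" using min by simp
      then have "y \<bullet> (A *v y) * (norm x)\<^sup>2 \<le> (u \<bullet> (A *v u)) * (norm x)\<^sup>2"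
        by (intro mult_right_mono) auto
      also have "\<dots> = (norm x *\<^sub>R u) \<bullet> (A *v (norm x *\<^sub>R u))"
        by (simp add: matrix_vector_mult_scaleR power2_eq_square)
      also have "\<dots> = x \<bullet> (A *v x)"
        by (simp only: x[symmetric])
      finally show ?thesis .
    qed simp
  qed
qed

lemma spd_invertible:
  assumes "symmetric_positive_definite A"
  shows "invertible A"
proof -
  have "x = 0" if "A *v x = 0" for x
    using assms that by (force simp: symmetric_positive_definite_def)
  then show ?thesis
    unfolding invertible_left_inverse matrix_left_invertible_ker by blast
qed

lemma spd_congruence:
  fixes A M :: "real^'n^'n"
  assumes "symmetric_positive_definite A" "invertible M"
  shows "symmetric_positive_definite (transpose M ** A ** M)"
proof -
  have form: "x \<bullet> ((transpose M ** A ** M) *v y) = (M *v x) \<bullet> (A *v (M *v y))" for x y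
    by (simp add: matrix_vector_mul_assoc[symmetric] dot_lmul_matrix inner_commute[of x])
      (simp add: inner_commute)
  have "M *v x \<noteq> 0" if "x \<noteq> 0" for x
    using that assms(2) matrix_left_invertible_ker[of M] invertible_left_inverse[of M] by metis
  then show ?thesis
    using assms(1) unfolding spd_iff_form form by blast
qed

lemma
  fixes A :: "real^'n^'n"
  assumes "invertible A"
  shows mult_matrix_inv: "A ** matrix_inv A = mat 1"
    and matrix_inv_mult: "matrix_inv A ** A = mat 1"
  using assms someI_ex[of "\<lambda>A'. A ** A' = mat 1 \<and> A' ** A = mat 1"]
  unfolding invertible_def matrix_inv_def by blast+

lemma spd_matrix_inv:
  fixes A :: "real^'n^'n"
  assumes A: "symmetric_positive_definite A"
  shows "symmetric_positive_definite (matrix_inv A)"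
proof -
  let ?B = "matrix_inv A"
  have inv: "A ** ?B = mat 1" "invertible ?B"
    using mult_matrix_inv[OF spd_invertible[OF A]] matrix_inv_mult[OF spd_invertible[OF A]]
    unfolding invertible_def by blast+
  have "transpose ?B ** A ** ?B = transpose ?B"
    by (simp add: matrix_mul_assoc[symmetric] inv)
  then have "symmetric_positive_definite (transpose ?B)"
    using spd_congruence[OF A inv(2)] by simp
  then have "transpose ?B = transpose (transpose ?B)"
    unfolding symmetric_positive_definite_def by (elim conjE) (rule sym)
  then show ?thesis
    using \<open>symmetric_positive_definite (transpose ?B)\<close> by (simp only: transpose_iff)
qed

section \<open>Linear changes of variables and Gaussian integrals\<close>

text \<open>
  The identity matrix with row \<open>p\<close> replaced by \<open>v\<close>. Products of these elementary matrices are the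
  only linear substitutions that occur below, so that the transformation formula for integrals has
  to be shown for them alone, by Fubini in the coordinate \<open>p\<close>.
\<close>
definition replace_row :: "'n \<Rightarrow> real^'n \<Rightarrow> real^'n^'n" where
  "replace_row p v = (\<chi> i. if i = p then v else axis i 1)"

lemma replace_row_mult:
  "replace_row p v *v x = (\<chi> i. if i = p then v \<bullet> x else x $ i)"
  by (simp add: replace_row_def vec_eq_iff matrix_vector_mul_component inner_axis')

text \<open>
  The entries of \<open>v\<close> off the diagonal come from adding multiples of the other rows, which are
  unit vectors, to \<open>v\<^sub>p e\<^sub>p\<close>; this leaves the determinant unchanged.
\<close>
lemma det_replace_row: "det (replace_row p v) = v $ p"
proof -
  let ?D = "\<chi> i. if i = p then (v $ p) *s axis p 1 else axis i (1::real)"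
  have D: "det ?D = v $ p"
  proof -
    have "det ?D = (\<Prod>i\<in>UNIV. ?D $ i $ i)"
      by (rule det_diagonal) (auto simp: axis_def)
    also have "\<dots> = (\<Prod>i\<in>UNIV. if i = p then v $ p else 1)"
      by (intro prod.cong) auto
    also have "\<dots> = v $ p" by simp
    finally show ?thesis .
  qed
  let ?x = "\<Sum>j\<in>-{p}. (v $ j) *s axis j (1::real)"
  have rows: "row k ?D = (if k = p then (v $ p) *s axis p 1 else axis k 1)" for k
    by (simp add: row_def vec_eq_iff)
  have "axis j 1 \<in> {row k ?D |k. k \<noteq> p}" if "j \<noteq> p" for j
    using that rows[of j] by (intro CollectI exI[of _ j]) simp
  then have "?x \<in> vec.span {row k ?D |k. k \<noteq> p}"
    by (intro vec.span_sum vec.span_scale vec.span_base) auto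
  from det_row_span[OF this] D
  have "det (\<chi> k. if k = p then row p ?D + ?x else row k ?D) = v $ p" by simp
  moreover have "(v $ p) *s axis p 1 + ?x = v"
  proof -
    have "v = (\<Sum>j\<in>UNIV. (v $ j) *s axis j 1)"
      by (simp add: vec_eq_iff axis_def if_distrib cong: if_cong)
    also have "\<dots> = (v $ p) *s axis p 1 + ?x"
      by (subst sum.remove[of _ p]) (auto simp: Compl_eq_Diff_UNIV)
    finally show ?thesis by simp
  qed
  ultimately show ?thesis
    unfolding rows replace_row_def by (simp cong: if_cong)
qed

text \<open>
  With the other coordinates fixed, the substitution is an affine map of the line in the \<open>p\<close>-th
  coordinate: its slope is \<open>a\<close> and its offset \<open>c\<close> does not depend on that coordinate. So the claim
  reduces to one dimension by Fubini.
\<close>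
lemma nn_integral_lborel_coordinate_affine:
  fixes p :: "'a::euclidean_space" and f :: "'a \<Rightarrow> ennreal"
  assumes p: "p \<in> Basis" and a: "a \<noteq> 0"
    and [measurable]: "c \<in> borel_measurable borel" "f \<in> borel_measurable borel"
    and c: "\<And>x t. c (x + t *\<^sub>R p) = c x"
  shows "(\<integral>\<^sup>+x. f x \<partial>lborel) = ennreal \<bar>a\<bar> * (\<integral>\<^sup>+x. f (x + ((a - 1) * (x \<bullet> p) + c x) *\<^sub>R p) \<partial>lborel)"
proof -
  interpret product_sigma_finite "\<lambda>_::'a. lborel :: real measure" ..
  let ?R = "Basis - {p}"
  let ?M = "Pi\<^sub>M ?R (\<lambda>_. lborel :: real measure)"
  let ?s = "\<lambda>x. \<Sum>b\<in>?R. x b *\<^sub>R b"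
  have ins: "insert p ?R = Basis" using p by blast
  have fubini: "(\<integral>\<^sup>+x. g x \<partial>lborel) = (\<integral>\<^sup>+x. (\<integral>\<^sup>+y. g (?s x + y *\<^sub>R p) \<partial>lborel) \<partial>?M)"
    if [measurable]: "g \<in> borel_measurable borel" for g :: "'a \<Rightarrow> ennreal"
  proof -
    have "(\<integral>\<^sup>+x. g x \<partial>lborel) = (\<integral>\<^sup>+x. g (\<Sum>b\<in>Basis. x b *\<^sub>R b) \<partial>(Pi\<^sub>M Basis (\<lambda>_. lborel)))"
      by (subst lborel_eq) (simp add: nn_integral_distr)
    also have "\<dots> = (\<integral>\<^sup>+x. g (\<Sum>b\<in>Basis. x b *\<^sub>R b) \<partial>(Pi\<^sub>M (insert p ?R) (\<lambda>_. lborel)))"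
      by (simp only: ins)
    also have "\<dots> = (\<integral>\<^sup>+x. (\<integral>\<^sup>+y. g (\<Sum>b\<in>Basis. (x(p := y)) b *\<^sub>R b) \<partial>lborel) \<partial>?M)"
      by (subst product_nn_integral_insert) (auto simp: ins)
    also have "(\<lambda>x y. \<Sum>b\<in>Basis. (x(p := y)) b *\<^sub>R b) = (\<lambda>x y. ?s x + y *\<^sub>R p)"
      using p by (auto simp: fun_eq_iff sum.remove[of Basis p] intro!: sum.cong)
    finally show ?thesis by (simp add: fun_eq_iff)
  qed
  have sp: "?s x \<bullet> p = 0" for x
    using p by (auto simp: inner_sum_left inner_Basis intro!: sum.neutral)
  let ?T = "\<lambda>x. x + ((a - 1) * (x \<bullet> p) + c x) *\<^sub>R p"
  have T: "?T (?s x + y *\<^sub>R p) = ?s x + (c (?s x) + a * y) *\<^sub>R p" for x y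
    using p by (simp add: c sp inner_add_left scaleR_left_distrib scaleR_left_diff_distrib
        left_diff_distrib)
  have "ennreal \<bar>a\<bar> * (\<integral>\<^sup>+x. f (?T x) \<partial>lborel) = (\<integral>\<^sup>+x. ennreal \<bar>a\<bar> * f (?T x) \<partial>lborel)"
    by (rule nn_integral_cmult[symmetric]) measurable
  also have "\<dots> = (\<integral>\<^sup>+x. (\<integral>\<^sup>+y. ennreal \<bar>a\<bar> * f (?T (?s x + y *\<^sub>R p)) \<partial>lborel) \<partial>?M)"
    by (rule fubini) measurable
  also have "\<dots> = (\<integral>\<^sup>+x. (\<integral>\<^sup>+y. ennreal \<bar>a\<bar> * f (?s x + (c (?s x) + a * y) *\<^sub>R p) \<partial>lborel) \<partial>?M)"
    unfolding T ..
  also have "\<dots> = (\<integral>\<^sup>+x. (\<integral>\<^sup>+y. f (?s x + y *\<^sub>R p) \<partial>lborel) \<partial>?M)"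
  proof (rule nn_integral_cong)
    fix x
    have "(\<integral>\<^sup>+y. ennreal \<bar>a\<bar> * f (?s x + (c (?s x) + a * y) *\<^sub>R p) \<partial>lborel)
        = ennreal \<bar>a\<bar> * (\<integral>\<^sup>+y. f (?s x + (c (?s x) + a * y) *\<^sub>R p) \<partial>lborel)"
      by (rule nn_integral_cmult) measurable
    also have "\<dots> = (\<integral>\<^sup>+y. f (?s x + y *\<^sub>R p) \<partial>lborel)"
      by (rule nn_integral_real_affine[OF _ a, symmetric]) measurable
    finally show "(\<integral>\<^sup>+y. ennreal \<bar>a\<bar> * f (?s x + (c (?s x) + a * y) *\<^sub>R p) \<partial>lborel)
        = (\<integral>\<^sup>+y. f (?s x + y *\<^sub>R p) \<partial>lborel)" .
  qed
  also have "\<dots> = (\<integral>\<^sup>+x. f x \<partial>lborel)"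
    by (rule fubini[symmetric]) simp
  finally show ?thesis by simp
qed

text \<open>
  The transformation formula is carried as a property of the matrix because it is inherited by
  products.
\<close>
definition rescales_lborel :: "real^'n^'n \<Rightarrow> bool" where
  "rescales_lborel A \<longleftrightarrow> (\<forall>f\<in>borel_measurable borel.
     (\<integral>\<^sup>+x. f x \<partial>lborel) = ennreal \<bar>det A\<bar> * (\<integral>\<^sup>+x. f (A *v x) \<partial>lborel))"

lemma borel_measurable_matrix_vector_mult [measurable (raw)]:
  fixes A :: "real^'n^'m"
  assumes "f \<in> borel_measurable M"
  shows "(\<lambda>x. A *v f x) \<in> borel_measurable M"
proof -
  have "(*v) A \<in> borel_measurable borel"
    by (intro borel_measurable_continuous_onI continuous_intros)
  from measurable_compose[OF assms this] show ?thesis .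
qed

lemma rescales_lborel_mat_1: "rescales_lborel (mat 1)"
  by (simp add: rescales_lborel_def)

lemma rescales_lborel_mult:
  assumes "rescales_lborel A" "rescales_lborel B"
  shows "rescales_lborel (A ** B)"
  unfolding rescales_lborel_def
proof
  fix f :: "real^'a \<Rightarrow> ennreal" assume [measurable]: "f \<in> borel_measurable borel"
  have "(\<integral>\<^sup>+x. f x \<partial>lborel) = ennreal \<bar>det A\<bar> * (\<integral>\<^sup>+x. f (A *v x) \<partial>lborel)"
    using assms(1) unfolding rescales_lborel_def by (rule bspec) measurable
  also have "(\<integral>\<^sup>+x. f (A *v x) \<partial>lborel)
      = ennreal \<bar>det B\<bar> * (\<integral>\<^sup>+x. f (A *v (B *v x)) \<partial>lborel)"
    using assms(2) unfolding rescales_lborel_def by (rule bspec) measurable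
  finally show "(\<integral>\<^sup>+x. f x \<partial>lborel) =
      ennreal \<bar>det (A ** B)\<bar> * (\<integral>\<^sup>+x. f ((A ** B) *v x) \<partial>lborel)"
    by (simp only: matrix_vector_mul_assoc det_mul abs_mult ennreal_mult abs_ge_zero mult.assoc)
qed

lemma rescales_lborel_replace_row:
  assumes "v $ p \<noteq> 0"
  shows "rescales_lborel (replace_row p v)"
  unfolding rescales_lborel_def
proof
  fix f :: "real^'a \<Rightarrow> ennreal" assume f: "f \<in> borel_measurable borel"
  have eq: "replace_row p v *v x =
      x + ((v $ p - 1) * (x \<bullet> axis p 1) + (v - v $ p *\<^sub>R axis p 1) \<bullet> x) *\<^sub>R axis p 1" for x
    unfolding replace_row_mult vec_eq_iff
    by (simp add: inner_diff_left inner_axis inner_axis' left_diff_distrib)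
      (simp add: axis_def)
  have m: "(\<lambda>x. (v - v $ p *\<^sub>R axis p 1) \<bullet> x) \<in> borel_measurable borel"
    by (intro borel_measurable_continuous_onI continuous_intros)
  have p: "axis p (1::real) \<in> Basis" by (simp add: axis_in_Basis_iff)
  have c: "(v - v $ p *\<^sub>R axis p 1) \<bullet> (x + t *\<^sub>R axis p 1) = (v - v $ p *\<^sub>R axis p 1) \<bullet> x" for x t
    by (simp add: inner_add_right inner_diff_left inner_axis)
  show "(\<integral>\<^sup>+x. f x \<partial>lborel) =
      ennreal \<bar>det (replace_row p v)\<bar> * (\<integral>\<^sup>+x. f (replace_row p v *v x) \<partial>lborel)"
    using nn_integral_lborel_coordinate_affine[where f = f
          and c = "\<lambda>x. (v - v $ p *\<^sub>R axis p 1) \<bullet> x", OF p assms m f c]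
    unfolding det_replace_row eq .
qed

definition diag_matrix :: "('n \<Rightarrow> real) \<Rightarrow> real^'n^'n" where
  "diag_matrix r = (\<chi> i j. if i = j then r i else 0)"

lemma diag_matrix_mult: "diag_matrix r *v x = (\<chi> i. r i * x $ i)"
  by (simp add: diag_matrix_def vec_eq_iff matrix_vector_mult_def if_distrib[of "\<lambda>t. t * _"]
      cong: if_cong)

lemma det_diag_matrix: "det (diag_matrix r) = (\<Prod>i\<in>UNIV. r i)"
  by (subst det_diagonal) (simp_all add: diag_matrix_def)

lemma inner_diag_matrix: "x \<bullet> (diag_matrix r *v y) = (\<Sum>i\<in>UNIV. r i * x $ i * y $ i)"
  by (simp add: inner_vec_def diag_matrix_mult mult_ac)

lemma diag_matrix_mult_left: "(diag_matrix r ** A) $ i $ j = r i * A $ i $ j"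
  by (simp add: diag_matrix_def matrix_matrix_mult_def if_distrib[of "\<lambda>t. t * _"] cong: if_cong)

lemma diag_matrix_mult_right: "(A ** diag_matrix r) $ i $ j = A $ i $ j * r j"
  by (simp add: diag_matrix_def matrix_matrix_mult_def if_distrib[of "\<lambda>t. _ * t"] cong: if_cong)

text \<open>
  Scale one coordinate at a time.
\<close>
lemma rescales_lborel_diag_matrix:
  fixes r :: "'n::finite \<Rightarrow> real"
  assumes r: "\<And>i. r i \<noteq> 0"
  shows "rescales_lborel (diag_matrix r)"
proof -
  have "rescales_lborel (diag_matrix (\<lambda>i. if i \<in> K then r i else 1))" for K :: "'n set"
  proof (induction K rule: finite_induct[OF finite])
    case 1
    have "diag_matrix (\<lambda>i. if i \<in> {} then r i else 1) = mat 1"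
      by (simp add: diag_matrix_def mat_def)
    then show ?case using rescales_lborel_mat_1 by metis
  next
    case (2 p K)
    let ?v = "r p *\<^sub>R axis p 1"
    have "diag_matrix (\<lambda>i. if i \<in> insert p K then r i else 1) =
        replace_row p ?v ** diag_matrix (\<lambda>i. if i \<in> K then r i else 1)"
      unfolding matrix_eq
    proof
      fix x
      show "diag_matrix (\<lambda>i. if i \<in> insert p K then r i else 1) *v x =
          (replace_row p ?v ** diag_matrix (\<lambda>i. if i \<in> K then r i else 1)) *v x"
        using 2 by (auto simp: matrix_vector_mul_assoc[symmetric] replace_row_mult diag_matrix_mult
            vec_eq_iff inner_axis')
    qed
    moreover have "rescales_lborel (replace_row p ?v)"
      by (rule rescales_lborel_replace_row) (simp add: r)
    ultimately show ?case using rescales_lborel_mult 2 by simp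
  qed
  from this[of UNIV] show ?thesis by simp
qed

text \<open>
  Symmetric Gaussian elimination: each step clears the row and the column of a pivot \<open>p\<close> and
  normalises the diagonal entry, by one elementary substitution in the coordinate \<open>p\<close>. Earlier
  pivots are not disturbed, as their entries in column \<open>p\<close> vanish already. Working with elementary
  substitutions yields the transformation formula for the resulting \<open>A\<close> at the same time.
\<close>
lemma spd_congruent_to_identity:
  fixes S :: "real^'n^'n"
  assumes S: "symmetric_positive_definite S"
  obtains A where "transpose A ** S ** A = mat 1" "rescales_lborel A"
proof -
  have "\<exists>A. invertible A \<and> rescales_lborel A \<and>
      (\<forall>i\<in>K. \<forall>j. (transpose A ** S ** A) $ i $ j = mat 1 $ i $ j)" for K :: "'n set"
  proof (induction K rule: finite_induct[OF finite])
    case 1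
    show ?case
      using rescales_lborel_mat_1 by (intro exI[of _ "mat 1"]) (auto simp: invertible_def)
  next
    case (2 p K)
    then obtain A where A: "invertible A" "rescales_lborel A"
      and K: "\<And>i j. i \<in> K \<Longrightarrow> (transpose A ** S ** A) $ i $ j = mat 1 $ i $ j" by blast
    define N where "N = transpose A ** S ** A"
    have N: "symmetric_positive_definite N"
      unfolding N_def by (rule spd_congruence[OF S A(1)])
    have sym: "N $ i $ j = N $ j $ i" for i j
    proof -
      have "transpose N = N" using N by (simp add: symmetric_positive_definite_def)
      then have "transpose N $ j $ i = N $ j $ i" by simp
      then show ?thesis by (simp add: transpose_def)
    qed
    have pos: "N $ p $ p > 0"
    proof -
      have "axis p (1::real) \<noteq> 0" by (simp add: axis_eq_0_iff)
      then have "axis p 1 \<bullet> (N *v axis p 1) > 0"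
        using N by (simp add: symmetric_positive_definite_def)
      then show ?thesis by (simp add: inner_axis' matrix_vector_mul_component inner_axis)
    qed
    define s where "s = sqrt (N $ p $ p)"
    have s: "s > 0" "N $ p $ p = s * s" using pos by (simp_all add: s_def)
    define v where "v = (\<chi> j. if j = p then 1 / s else - N $ p $ j / N $ p $ p)"
    let ?E = "replace_row p v"
    have E: "?E $ l $ j = (if l = p then v $ j else if l = j then 1 else 0)" for l j
      by (simp add: replace_row_def axis_def)
    have split: "(\<Sum>l\<in>UNIV. g l) = g p + (\<Sum>l\<in>-{p}. g l)" for g :: "'n \<Rightarrow> real"
      by (subst sum.remove[of _ p]) (auto simp: Compl_eq_Diff_UNIV)
    have mid: "(\<Sum>l\<in>-{p}. g l * (if l = p then v $ j else if l = j then 1 else 0)) =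
        (if j = p then 0 else g j)" for g :: "'n \<Rightarrow> real" and j
    proof -
      have "(\<Sum>l\<in>-{p}. g l * (if l = p then v $ j else if l = j then 1 else 0))
          = (\<Sum>l\<in>-{p}. if l = j then g l else 0)"
        by (intro sum.cong) auto
      also have "\<dots> = (if j = p then 0 else g j)" by simp
      finally show ?thesis .
    qed
    have NE: "(N ** ?E) $ k $ j = (if j = p then 0 else N $ k $ j) + N $ k $ p * v $ j" for k j
    proof -
      have "(N ** ?E) $ k $ j = (\<Sum>l\<in>UNIV. N $ k $ l * ?E $ l $ j)"
        by (simp add: matrix_matrix_mult_def)
      then show ?thesis unfolding E split mid by simp
    qed
    have ENE: "(transpose ?E ** (N ** ?E)) $ i $ j =
        (if i = p then 0 else (N ** ?E) $ i $ j) + (N ** ?E) $ p $ j * v $ i" for i j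
    proof -
      have "(transpose B ** C) $ i $ j = (\<Sum>k\<in>UNIV. C $ k $ j * B $ k $ i)" for B C :: "real^'n^'n"
        by (simp add: matrix_matrix_mult_def transpose_def mult.commute)
      from this[of ?E "N ** ?E"]
      show ?thesis unfolding E split mid by simp
    qed
    have NEp: "(N ** ?E) $ p $ j = (if j = p then s else 0)" for j
      unfolding NE using s by (simp add: v_def)
    have v0: "v $ p \<noteq> 0" using s by (simp add: v_def)
    have "(transpose ?E ** (N ** ?E)) $ i $ j = mat 1 $ i $ j" if "i \<in> insert p K" for i j
    proof (cases "i = p")
      case True
      then show ?thesis unfolding ENE NEp using s by (simp add: v_def mat_def)
    next
      case False
      then have i: "i \<in> K" using that by blast
      have "N $ i $ p = 0" using K[OF i, of p] False by (simp add: N_def mat_def)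
      then show ?thesis
        unfolding ENE NEp NE using K[OF i, of j] False sym[of i p] by (auto simp: N_def[symmetric] v_def mat_def)
    qed
    moreover have "transpose (A ** ?E) ** S ** (A ** ?E) = transpose ?E ** (N ** ?E)"
      by (simp add: N_def matrix_transpose_mul matrix_mul_assoc)
    moreover have "invertible (A ** ?E)"
      using A(1) v0 by (intro invertible_mult) (simp_all add: invertible_det_nz det_replace_row)
    moreover have "rescales_lborel (A ** ?E)"
      by (intro rescales_lborel_mult A rescales_lborel_replace_row v0)
    ultimately show ?case by metis
  qed
  from this[of UNIV] obtain A where "rescales_lborel A"
    "\<forall>i j. (transpose A ** S ** A) $ i $ j = mat 1 $ i $ j" by auto
  then show thesis using that[of A] by (simp add: vec_eq_iff)
qed

lemma nn_integral_lborel_vec_prod: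
  fixes f :: "'n::finite \<Rightarrow> real \<Rightarrow> ennreal"
  assumes [measurable]: "\<And>i. f i \<in> borel_measurable borel"
  shows "(\<integral>\<^sup>+x. (\<Prod>i\<in>UNIV. f i (x $ i)) \<partial>(lborel :: (real^'n) measure)) = (\<Prod>i\<in>UNIV. \<integral>\<^sup>+t. f i t \<partial>lborel)"
proof -
  let ?e = "\<lambda>i::'n. axis i (1::real)"
  have inj: "inj ?e" by (auto simp: inj_def axis_eq_axis)
  have Basis: "(Basis :: (real^'n) set) = range ?e" by (auto simp: Basis_vec_def)
  have inv: "inv ?e (?e i) = i" for i by (rule inv_f_f[OF inj])
  have "(\<integral>\<^sup>+x. (\<Prod>b\<in>Basis. f (inv ?e b) (x \<bullet> b)) \<partial>(lborel :: (real^'n) measure))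
      = (\<Prod>b\<in>Basis. \<integral>\<^sup>+t. f (inv ?e b) t \<partial>lborel)"
    by (rule nn_integral_lborel_prod) auto
  then show ?thesis
    unfolding Basis prod.reindex[OF inj] by (simp add: inv inner_axis)
qed

lemma nn_integral_gaussian_1d: "(\<integral>\<^sup>+t. ennreal (exp (- t\<^sup>2 / 2)) \<partial>lborel) = ennreal (sqrt (2 * pi))"
proof -
  have "(\<integral>\<^sup>+t. ennreal (exp (- t\<^sup>2 / 2)) \<partial>lborel)
      = (\<integral>\<^sup>+t. ennreal (sqrt (2 * pi)) * ennreal (std_normal_density t) \<partial>lborel)"
    by (intro nn_integral_cong) (simp add: std_normal_density_def ennreal_mult[symmetric])
  also have "\<dots> = ennreal (sqrt (2 * pi)) * (\<integral>\<^sup>+t. ennreal (std_normal_density t) \<partial>lborel)"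
    by (rule nn_integral_cmult) simp
  also have "(\<integral>\<^sup>+t. ennreal (std_normal_density t) \<partial>lborel) = 1"
    by (simp add: nn_integral_eq_integral)
  finally show ?thesis by simp
qed

text \<open>
  The substitution \<open>x \<mapsto> A x\<close> with \<open>A\<^sup>T S A = 1\<close> reduces the integral to a product of
  one-dimensional ones, and \<open>(det A)\<^sup>2 det S = 1\<close> accounts for the Jacobian.
\<close>
proposition gaussian_integral:
  fixes S :: "real^'n^'n"
  assumes S: "symmetric_positive_definite S"
  shows "det S > 0"
    and "sqrt (det S) * (LINT x|lborel. exp (- 1 / 2 * (x \<bullet> (S *v x)))) = sqrt ((2 * pi) ^ CARD('n))"
proof -
  obtain A where A: "transpose A ** S ** A = mat 1" "rescales_lborel A"
    using spd_congruent_to_identity[OF S] .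
  have "det (transpose A ** S ** A) = 1" unfolding A(1) by simp
  then have det: "(det A)\<^sup>2 * det S = 1"
    by (simp add: det_mul power2_eq_square mult_ac)
  then show pos: "det S > 0"
    by (metis zero_less_mult_pos zero_less_one zero_le_power2 less_le mult_eq_0_iff zero_neq_one)
  have form: "(A *v x) \<bullet> (S *v (A *v x)) = x \<bullet> x" for x
  proof -
    have "x \<bullet> x = x \<bullet> ((transpose A ** S ** A) *v x)" by (simp add: A(1))
    also have "\<dots> = (A *v x) \<bullet> (S *v (A *v x))"
      by (simp add: matrix_vector_mul_assoc[symmetric] dot_lmul_matrix inner_commute[of x])
        (simp add: inner_commute)
    finally show ?thesis by simp
  qed
  have [measurable]: "(\<lambda>x. exp (- 1 / 2 * (x \<bullet> (S *v x)))) \<in> borel_measurable borel"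
    by (intro borel_measurable_continuous_onI continuous_intros)
  have "(\<integral>\<^sup>+x. ennreal (exp (- 1 / 2 * (x \<bullet> (S *v x)))) \<partial>lborel)
      = ennreal \<bar>det A\<bar> * (\<integral>\<^sup>+x. ennreal (exp (- 1 / 2 * ((A *v x) \<bullet> (S *v (A *v x))))) \<partial>lborel)"
    using A(2) unfolding rescales_lborel_def by (rule bspec) measurable
  also have "(\<lambda>x. ennreal (exp (- 1 / 2 * ((A *v x) \<bullet> (S *v (A *v x))))))
      = (\<lambda>x. \<Prod>i\<in>UNIV. ennreal (exp (- (x $ i)\<^sup>2 / 2)))"
    unfolding form by (simp add: prod_ennreal exp_sum[symmetric] inner_vec_def power2_eq_square
        sum_divide_distrib sum_negf)
  also have "(\<integral>\<^sup>+x. (\<Prod>i\<in>UNIV. ennreal (exp (- (x $ i)\<^sup>2 / 2))) \<partial>(lborel :: (real^'n) measure))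
      = ennreal (sqrt (2 * pi) ^ CARD('n))"
    by (subst nn_integral_lborel_vec_prod) (simp_all only: nn_integral_gaussian_1d, simp_all add: ennreal_power)
  finally have nn: "(\<integral>\<^sup>+x. ennreal (exp (- 1 / 2 * (x \<bullet> (S *v x)))) \<partial>lborel)
      = ennreal (\<bar>det A\<bar> * sqrt (2 * pi) ^ CARD('n))"
    by (simp add: ennreal_mult)
  have "(LINT x|lborel. exp (- 1 / 2 * (x \<bullet> (S *v x)))) = \<bar>det A\<bar> * sqrt (2 * pi) ^ CARD('n)"
    by (subst integral_eq_nn_integral) (simp_all only: nn, simp_all)
  moreover have "sqrt (det S) * \<bar>det A\<bar> = 1"
  proof -
    have "sqrt (det S) * \<bar>det A\<bar> = sqrt ((det A)\<^sup>2 * det S)" by (simp add: real_sqrt_mult mult.commute)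
    then show ?thesis by (simp add: det)
  qed
  ultimately show "sqrt (det S) * (LINT x|lborel. exp (- 1 / 2 * (x \<bullet> (S *v x)))) = sqrt ((2 * pi) ^ CARD('n))"
    unfolding real_sqrt_power by (simp only: mult.assoc[symmetric] mult_1)
qed

section \<open>Solutions of the logarithmic equations have no bounded component\<close>

lemma inner_vec_sum: "(x::real^'n) \<bullet> y = (\<Sum>i\<in>UNIV. x $ i * y $ i)"
  by (simp add: inner_vec_def)

text \<open>
  The principal submatrix of \<open>S\<close> on \<open>P\<close> is positive definite, hence invertible. To stay within one
  vector type it is completed to the square matrix \<open>T\<close> by the identity off \<open>P\<close>.
\<close>
lemma spd_solve_on:
  fixes S :: "real^'n^'n"
  assumes S: "symmetric_positive_definite S"
  obtains w where "\<And>k. k \<notin> P \<Longrightarrow> w $ k = 0" "\<And>k. k \<in> P \<Longrightarrow> (S *v w) $ k = b $ k"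
proof -
  define T :: "real^'n^'n" where
    "T = (\<chi> k j. if k \<in> P then (if j \<in> P then S $ k $ j else 0) else (if k = j then 1 else 0))"
  define res :: "real^'n \<Rightarrow> real^'n" where "res x = (\<chi> j. if j \<in> P then x $ j else 0)" for x
  have T_in: "(T *v x) $ k = (S *v res x) $ k" if "k \<in> P" for x k
    using that by (auto simp: T_def res_def matrix_vector_mult_def intro!: sum.cong)
  have T_out: "(T *v x) $ k = x $ k" if "k \<notin> P" for x k
    using that by (simp add: T_def matrix_vector_mult_def if_distrib[of "\<lambda>t. t * _"] cong: if_cong)
  have "x = 0" if "T *v x = 0" for x
  proof -
    have "x $ k = 0" if "k \<notin> P" for k using T_out[OF that, of x] \<open>T *v x = 0\<close> by simp
    then have res: "res x = x" by (auto simp: res_def vec_eq_iff)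
    have "x $ k * (S *v x) $ k = 0" for k
      using T_in[of k x] T_out[of k x] \<open>T *v x = 0\<close> res by (cases "k \<in> P") auto
    then have "x \<bullet> (S *v x) = 0" unfolding inner_vec_sum by (intro sum.neutral) blast
    then show "x = 0" using S unfolding symmetric_positive_definite_def by force
  qed
  then have "invertible T"
    unfolding invertible_left_inverse matrix_left_invertible_ker by blast
  define b' where "b' = (\<chi> k. if k \<in> P then b $ k else 0)"
  define w where "w = matrix_inv T *v b'"
  have Tw: "T *v w = b'"
    by (simp add: w_def matrix_vector_mul_assoc mult_matrix_inv[OF \<open>invertible T\<close>])
  have out: "w $ k = 0" if "k \<notin> P" for k
    using T_out[OF that, of w] that by (simp add: Tw b'_def)
  then have "res w = w" by (auto simp: res_def vec_eq_iff)
  then have "(S *v w) $ k = b $ k" if "k \<in> P" for k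
    using T_in[OF that, of w] that by (simp add: Tw b'_def)
  with out show thesis using that by blast
qed

lemma Bseq_add_Bseq:
  fixes f g :: "nat \<Rightarrow> real"
  assumes "Bseq f" "Bseq g" shows "Bseq (\<lambda>k. f k + g k)"
proof -
  obtain A B where "\<And>k. norm (f k) \<le> A" "\<And>k. norm (g k) \<le> B"
    using assms unfolding Bseq_def by blast
  then have "norm (f k + g k) \<le> A + B" for k
    using norm_triangle_ineq[of "f k" "g k"] by (meson add_mono order_trans)
  then show ?thesis by (rule BseqI')
qed

lemma Bseq_diff_Bseq:
  fixes f g :: "nat \<Rightarrow> real"
  assumes "Bseq f" "Bseq g" shows "Bseq (\<lambda>k. f k - g k)"
  using Bseq_add_Bseq[OF assms(1), of "\<lambda>k. - g k"] assms(2) by (simp add: Bseq_minus_iff)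

lemma Bseq_sum:
  fixes f :: "'a \<Rightarrow> nat \<Rightarrow> real"
  assumes "\<And>i. i \<in> A \<Longrightarrow> Bseq (f i)"
  shows "Bseq (\<lambda>k. \<Sum>i\<in>A. f i k)"
  using assms by (induction A rule: infinite_finite_induct) (auto intro: Bseq_add_Bseq simp: Bfun_const)

lemma Bseq_div_tendsto_0:
  fixes f M :: "nat \<Rightarrow> real"
  assumes f: "Bseq f" and M: "filterlim M at_top sequentially"
  shows "(\<lambda>k. f k / M k) \<longlonglongrightarrow> 0"
proof -
  have "Zfun (\<lambda>k. inverse (M k)) sequentially"
    using tendsto_inverse_0_at_top[OF M] by (simp add: tendsto_Zfun_iff)
  from bounded_bilinear.Bfun_prod_Zfun[OF bounded_bilinear_mult f this]
  show ?thesis by (simp add: tendsto_Zfun_iff divide_inverse)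
qed

text \<open>
  For \<open>i \<notin> P\<close> the vector \<open>z i\<close> is the part of the unit vector \<open>e\<^sub>i\<close> that is \<open>S\<close>-orthogonal to the coordinate
  subspace of \<open>P\<close>. The \<open>S\<close>-Gram matrix of these \<open>z i\<close> is the Schur complement of the block \<open>P\<close> in \<open>S\<close>;
  adding the \<open>e\<^sub>i\<close> with \<open>i \<in> P\<close> makes it a congruence transform of the whole matrix, and positive
  definiteness is immediate. In the last property \<open>y\<close> itself stands on the right, because the
  difference between \<open>y\<close> and its image under the transformation is supported on \<open>P\<close>.
\<close>
lemma spd_schur_congruence:
  fixes S :: "real^'n^'n"
  assumes S: "symmetric_positive_definite S"
  obtains S' z where "symmetric_positive_definite S'"
    "\<And>i k. i \<notin> P \<Longrightarrow> k \<in> P \<Longrightarrow> (S *v z i) $ k = 0"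
    "\<And>i k. k \<notin> P \<Longrightarrow> z i $ k = (if k = i then 1 else 0)"
    "\<And>i y. i \<notin> P \<Longrightarrow> (S' *v y) $ i = z i \<bullet> (S *v y)"
proof -
  have "\<exists>w. (\<forall>k. k \<notin> P \<longrightarrow> w $ k = 0) \<and> (\<forall>k\<in>P. (S *v w) $ k = (S *v axis i 1) $ k)" for i
    using spd_solve_on[OF S, of P "S *v axis i 1"] by metis
  then obtain w where w_out: "\<And>i k. k \<notin> P \<Longrightarrow> w i $ k = 0"
    and w_in: "\<And>i k. k \<in> P \<Longrightarrow> (S *v w i) $ k = (S *v axis i 1) $ k" by metis
  define z where "z i = (if i \<in> P then axis i 1 else axis i 1 - w i)" for i
  have z_ortho: "(S *v z i) $ k = 0" if "i \<notin> P" "k \<in> P" for i k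
    using that by (simp add: z_def matrix_vector_mult_diff_distrib w_in)
  have z_out: "z i $ k = (if k = i then 1 else 0)" if "k \<notin> P" for i k
    using that by (auto simp: z_def w_out axis_def)
  define M where "M = (\<chi> k i. z i $ k)"
  have M: "(M *v y) $ k = (\<Sum>i\<in>UNIV. z i $ k * y $ i)" for y k
    by (simp add: M_def matrix_vector_mult_def)
  have M_out: "(M *v y) $ k = y $ k" if "k \<notin> P" for y k
    unfolding M z_out[OF that] by (simp add: if_distrib[of "\<lambda>t. t * _"] cong: if_cong)
  have "x = 0" if x: "M *v x = 0" for x
  proof -
    have out: "x $ k = 0" if "k \<notin> P" for k using M_out[OF that, of x] x by simp
    have "x $ k = 0" for k
    proof -
      have "(M *v x) $ k = (\<Sum>i\<in>UNIV. if i = k then x $ i else 0)"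
        unfolding M using out by (intro sum.cong) (auto simp: z_def axis_def)
      then show ?thesis using x by simp
    qed
    then show ?thesis by (simp add: vec_eq_iff)
  qed
  then have "invertible M"
    unfolding invertible_left_inverse matrix_left_invertible_ker by blast
  from spd_congruence[OF S this] have S': "symmetric_positive_definite (transpose M ** S ** M)" .
  have "((transpose M ** S ** M) *v y) $ i = z i \<bullet> (S *v y)" if i: "i \<notin> P" for i y
  proof -
    have "((transpose M ** S ** M) *v y) $ i = (transpose M *v (S *v (M *v y))) $ i"
      by (simp add: matrix_vector_mul_assoc matrix_mul_assoc)
    also have "\<dots> = z i \<bullet> (S *v (M *v y))"
      unfolding matrix_vector_mul_component[of "transpose M"]
      by (rule arg_cong[where f = "\<lambda>v. v \<bullet> _"]) (simp add: M_def transpose_def vec_eq_iff)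
    finally have 1: "((transpose M ** S ** M) *v y) $ i = z i \<bullet> (S *v (M *v y))" .
    have "z i \<bullet> (S *v (M *v y - y)) = (M *v y - y) \<bullet> (S *v z i)"
      by (rule spd_symmetric_form[OF S])
    also have "\<dots> = 0"
      unfolding inner_vec_sum using M_out[of _ y] z_ortho[OF i]
      by (intro sum.neutral) (metis cancel_comm_monoid_add_class.diff_cancel mult_zero_left mult_zero_right vector_minus_component)
    finally show ?thesis using 1 by (simp add: matrix_vector_mult_diff_distrib inner_diff_right)
  qed
  with S' z_ortho z_out show thesis using that by blast
qed

text \<open>
  Pair the system with \<open>x\<close>: the left side is at least \<open>c |x|\<^sup>2\<close>, while \<open>- t ln t \<le> 1\<close> bounds
  the right side by a multiple of \<open>|x| L\<close>.
\<close>
lemma log_equation_bound: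
  fixes S :: "real^'n^'n"
  assumes S: "symmetric_positive_definite S"
  shows "\<exists>K>0. \<forall>x L. L \<ge> 1 \<longrightarrow> (\<forall>i\<in>F. x $ i > 0) \<longrightarrow> (\<forall>i. i \<notin> F \<longrightarrow> x $ i = 0) \<longrightarrow>
       (\<forall>i\<in>F. (S *v x) $ i + ln (x $ i) - L \<le> C) \<longrightarrow> norm x \<le> K * L"
proof -
  obtain c where c: "c > 0" "\<And>x. c * (norm x)\<^sup>2 \<le> x \<bullet> (S *v x)" by (rule spd_coercive[OF S]) blast
  define n where "n = real CARD('n)"
  define K where "K = max 1 (n * (\<bar>C\<bar> + 2) / c)"
  have "norm x \<le> K * L" if L: "L \<ge> 1" and pos: "\<And>i. i \<in> F \<Longrightarrow> x $ i > 0"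
    and zero: "\<And>i. i \<notin> F \<Longrightarrow> x $ i = 0"
    and eq: "\<And>i. i \<in> F \<Longrightarrow> (S *v x) $ i + ln (x $ i) - L \<le> C" for x L
  proof (cases "norm x \<le> 1")
    case True
    have "1 * 1 \<le> K * L" using L by (intro mult_mono) (auto simp: K_def)
    with True show ?thesis by simp
  next
    case False
    have "x $ i * (S *v x) $ i \<le> norm x * L * (\<bar>C\<bar> + 2)" for i
    proof (cases "i \<in> F")
      case True
      have p: "x $ i > 0" using pos True .
      have "1 - 1 / x $ i \<le> ln (x $ i)"
        using ln_le_minus_one[of "1 / x $ i"] p by (simp add: ln_div)
      then have "x $ i * (1 - 1 / x $ i) \<le> x $ i * ln (x $ i)"
        using p by (intro mult_left_mono) auto
      then have ln: "- (x $ i * ln (x $ i)) \<le> 1" using p by (simp add: algebra_simps)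
      have le: "x $ i \<le> norm x" using component_le_norm_cart[of x i] by simp
      have "x $ i * (S *v x) $ i \<le> x $ i * (L + C - ln (x $ i))"
        using p eq[OF True] by (intro mult_left_mono) auto
      also have "\<dots> = x $ i * (L + C) - x $ i * ln (x $ i)" by (simp add: algebra_simps)
      also have "\<dots> \<le> x $ i * (L + \<bar>C\<bar>) + 1" using ln p by (intro diff_le_eq[THEN iffD2]) (smt (verit) mult_left_mono)
      also have "\<dots> \<le> norm x * (L + \<bar>C\<bar>) + norm x"
        using False L le by (intro add_mono mult_right_mono) auto
      also have "\<dots> = norm x * (L + \<bar>C\<bar> + 1)" by (simp add: algebra_simps)
      also have "\<dots> \<le> norm x * (L * (\<bar>C\<bar> + 2))"
      proof (intro mult_left_mono)
        have "1 * (\<bar>C\<bar> + 1) \<le> L * (\<bar>C\<bar> + 1)" using L by (intro mult_right_mono) auto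
        then show "L + \<bar>C\<bar> + 1 \<le> L * (\<bar>C\<bar> + 2)" by (simp add: algebra_simps)
      qed simp
      finally show ?thesis by (simp add: mult.assoc)
    qed (use zero L in simp)
    then have "x \<bullet> (S *v x) \<le> (\<Sum>i\<in>(UNIV::'n set). norm x * L * (\<bar>C\<bar> + 2))"
      unfolding inner_vec_sum by (rule sum_mono)
    also have "\<dots> = norm x * (n * L * (\<bar>C\<bar> + 2))" by (simp add: n_def)
    finally have "norm x * (c * norm x) \<le> norm x * (n * L * (\<bar>C\<bar> + 2))"
      using c(2)[of x] by (simp add: power2_eq_square mult_ac)
    then have "c * norm x \<le> n * L * (\<bar>C\<bar> + 2)" using False by (auto simp: mult_le_cancel_left)
    then have "norm x \<le> n * (\<bar>C\<bar> + 2) / c * L" using c(1) by (simp add: field_simps)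
    also have "\<dots> \<le> K * L" using L by (intro mult_right_mono) (auto simp: K_def)
    finally show ?thesis .
  qed
  moreover have "K > 0" by (simp add: K_def)
  ultimately show ?thesis by (intro exI[of _ K] conjI) blast+
qed

text \<open>
  Induction on the number of active indices \<open>F\<close>. Assume that \<open>ln \<lambda>\<^sub>i\<close> is bounded for \<open>i = i0\<close> and pass to
  a subsequence with \<open>\<lambda> / L \<rightarrow> \<nu>\<close>. Dividing the equations by \<open>L\<close> gives \<open>ln \<lambda>\<^sub>i / L \<rightarrow> 1 - (S \<nu>)\<^sub>i\<close>, which
  splits \<open>F\<close> into three groups: \<open>P\<close>, where \<open>\<nu>\<^sub>i > 0\<close> and \<open>(S \<nu>)\<^sub>i = 1\<close>; \<open>F'\<close>, where \<open>\<nu>\<^sub>i = 0\<close> and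
  \<open>(S \<nu>)\<^sub>i = 1\<close>; and the rest, where \<open>\<lambda>\<^sub>i \<rightarrow> 0\<close>. The index \<open>i0\<close> lies in \<open>F'\<close>.

  For \<open>i \<in> F'\<close> test the equations with the vector \<open>z i\<close> of the Schur complement of \<open>P\<close>. Its entries
  on \<open>P\<close> add up to \<open>-1\<close>, because \<open>z i \<bullet> S \<nu> = 0\<close> whereas \<open>S \<nu>\<close> equals \<open>1\<close> at \<open>i\<close> and on \<open>P\<close>.
  Therefore \<open>L\<close> cancels, and the terms \<open>ln \<lambda>\<^sub>j = ln L + O(1)\<close> with \<open>j \<in> P\<close> leave exactly \<open>ln L\<close> on the
  right. The result is a system of the same form for the smaller set \<open>F'\<close>.
\<close>
lemma no_bounded_log_component:
  fixes S :: "real^'n^'n" and lam :: "nat \<Rightarrow> real^'n"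
  assumes "symmetric_positive_definite S"
    and "\<And>k i. i \<in> F \<Longrightarrow> lam k $ i > 0" and "\<And>k i. i \<notin> F \<Longrightarrow> lam k $ i = 0"
    and "filterlim L at_top sequentially"
    and "\<And>i. i \<in> F \<Longrightarrow> Bseq (\<lambda>k. (S *v lam k) $ i + ln (lam k $ i) - L k)"
    and "i0 \<in> F"
  shows "\<not> Bseq (\<lambda>k. ln (lam k $ i0))"
  using assms
proof (induction "card F" arbitrary: S lam L F rule: less_induct)
  case less
  note S = less.prems(1)
  show ?case
  proof
    assume B0: "Bseq (\<lambda>k. ln (lam k $ i0))"
    have "\<exists>C. \<forall>k. (S *v lam k) $ i + ln (lam k $ i) - L k \<le> C" if "i \<in> F" for i
      using less.prems(5)[OF that] unfolding Bseq_def real_norm_def by (meson abs_le_D1)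
    then obtain C where C: "\<And>i k. i \<in> F \<Longrightarrow> (S *v lam k) $ i + ln (lam k $ i) - L k \<le> C i"
      by metis
    have C': "(S *v lam k) $ i + ln (lam k $ i) - L k \<le> (\<Sum>i\<in>F. \<bar>C i\<bar>)" if "i \<in> F" for i k
    proof -
      have "\<bar>C i\<bar> \<le> (\<Sum>i\<in>F. \<bar>C i\<bar>)" using that by (intro member_le_sum) auto
      then show ?thesis using C[OF that, of k] by linarith
    qed
    obtain K where K: "K > 0" "\<forall>x L. L \<ge> 1 \<longrightarrow> (\<forall>i\<in>F. x $ i > 0) \<longrightarrow> (\<forall>i. i \<notin> F \<longrightarrow> x $ i = 0) \<longrightarrow>
       (\<forall>i\<in>F. (S *v x) $ i + ln (x $ i) - L \<le> (\<Sum>i\<in>F. \<bar>C i\<bar>)) \<longrightarrow> norm x \<le> K * L"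
      using log_equation_bound[OF S, of F "\<Sum>i\<in>F. \<bar>C i\<bar>"] by blast
    have lamK: "norm (lam k) \<le> K * L k" if "L k \<ge> 1" for k
      using K(2)[rule_format, of "L k" "lam k"] that less.prems(2,3) C' by blast
    have "eventually (\<lambda>k. L k \<ge> 1) sequentially"
      using less.prems(4) by (simp add: filterlim_at_top)
    then obtain k0 where k0: "\<And>k. k \<ge> k0 \<Longrightarrow> L k \<ge> 1"
      unfolding eventually_sequentially by blast
    have "(1 / L (k + k0)) *\<^sub>R lam (k + k0) \<in> cball 0 K" for k
      using lamK[of "k + k0"] k0[of "k + k0"] by (simp add: field_simps)
    then obtain \<nu> r where r: "strict_mono (r :: nat \<Rightarrow> nat)"
      and \<nu>: "((\<lambda>k. (1 / L (k + k0)) *\<^sub>R lam (k + k0)) \<circ> r) \<longlonglongrightarrow> \<nu>"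
      using compact_cball[of "0::real^'n" K, unfolded compact_def, rule_format,
          of "\<lambda>k. (1 / L (k + k0)) *\<^sub>R lam (k + k0)"] by blast
    define s where "s k = r k + k0" for k
    define a where "a k = lam (s k)" for k
    define M where "M k = L (s k)" for k
    have s: "filterlim s at_top sequentially"
      unfolding s_def by (rule filterlim_compose[OF filterlim_add_const_nat_at_top filterlim_subseq[OF r]])
    have M: "filterlim M at_top sequentially"
      unfolding M_def by (rule filterlim_compose[OF less.prems(4) s])
    have M1: "M k \<ge> 1" for k unfolding M_def s_def by (rule k0) simp
    have lnM: "filterlim (\<lambda>k. ln (M k)) at_top sequentially"
      by (rule filterlim_compose[OF ln_at_top M])
    have a\<nu>: "(\<lambda>k. (1 / M k) *\<^sub>R a k) \<longlonglongrightarrow> \<nu>"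
      using \<nu> by (simp add: o_def M_def a_def s_def)
    then have ai: "(\<lambda>k. a k $ i / M k) \<longlonglongrightarrow> \<nu> $ i" for i
      using tendsto_vec_nth[OF a\<nu>, of i] by simp
    have a_pos: "a k $ i > 0" if "i \<in> F" for k i using that less.prems(2) by (simp add: a_def)
    have a_zero: "a k $ i = 0" if "i \<notin> F" for k i using that less.prems(3) by (simp add: a_def)
    have Sa: "(\<lambda>k. (S *v a k) $ i / M k) \<longlonglongrightarrow> (S *v \<nu>) $ i" for i
    proof -
      have "(\<lambda>k. (S *v ((1 / M k) *\<^sub>R a k)) $ i) \<longlonglongrightarrow> (S *v \<nu>) $ i"
        unfolding matrix_vector_mul_component by (intro tendsto_intros a\<nu>)
      then show ?thesis by (simp add: matrix_vector_mult_scaleR)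
    qed
    have eqn: "Bseq (\<lambda>k. (S *v a k) $ i + ln (a k $ i) - M k)" if "i \<in> F" for i
      using Bseq_subseq[OF less.prems(5)[OF that], of s] by (simp add: a_def M_def)
    have ln_lim: "(\<lambda>k. ln (a k $ i) / M k) \<longlonglongrightarrow> 1 - (S *v \<nu>) $ i" if "i \<in> F" for i
    proof -
      have "(\<lambda>k. ((S *v a k) $ i + ln (a k $ i) - M k) / M k + 1 - (S *v a k) $ i / M k)
          \<longlonglongrightarrow> 0 + 1 - (S *v \<nu>) $ i"
        by (intro tendsto_intros Bseq_div_tendsto_0 eqn that M Sa)
      moreover have "((S *v a k) $ i + ln (a k $ i) - M k) / M k + 1 - (S *v a k) $ i / M k
          = ln (a k $ i) / M k" for k
        using M1[of k] by (simp add: field_simps)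
      ultimately show ?thesis by simp
    qed
    define P where "P = {i. \<nu> $ i > 0}"
    define F' where "F' = {i\<in>F. \<nu> $ i = 0 \<and> (S *v \<nu>) $ i = 1}"
    have \<nu>0: "\<nu> $ i \<ge> 0" for i
    proof (cases "i \<in> F")
      case True
      then show ?thesis
        using a_pos M1 by (intro LIMSEQ_le_const[OF ai]) (metis divide_nonneg_nonneg less_imp_le order.trans zero_le_one)
    next
      case False
      have "(\<lambda>k. a k $ i / M k) \<longlonglongrightarrow> 0" using a_zero[OF False] by simp
      from LIMSEQ_unique[OF ai this] show ?thesis by simp
    qed
    have P_F: "P \<subseteq> F"
    proof
      fix i assume "i \<in> P"
      show "i \<in> F"
      proof (rule ccontr)
        assume False: "i \<notin> F"
        have "(\<lambda>k. a k $ i / M k) \<longlonglongrightarrow> 0" using a_zero[OF False] by simp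
        from LIMSEQ_unique[OF ai this] show False using \<open>i \<in> P\<close> by (simp add: P_def)
      qed
    qed
    \<comment> \<open>Components comparable to \<open>M\<close> have logarithm \<open>ln M + O(1)\<close>.\<close>
    have lnP: "Bseq (\<lambda>k. ln (a k $ i) - ln (M k))" if "i \<in> P" for i
    proof -
      have "(\<lambda>k. ln (a k $ i / M k)) \<longlonglongrightarrow> ln (\<nu> $ i)"
        using that by (intro tendsto_intros ai) (simp add: P_def)
      then have "Bseq (\<lambda>k. ln (a k $ i / M k))" by (intro convergent_imp_Bseq) (auto simp: convergent_def)
      moreover have "ln (a k $ i / M k) = ln (a k $ i) - ln (M k)" for k
      proof -
        have "0 < a k $ i" using a_pos that P_F by blast
        moreover have "0 < M k" using M1[of k] by linarith
        ultimately show ?thesis by (simp add: ln_div)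
      qed
      ultimately show ?thesis by simp
    qed
    have lnM_M: "(\<lambda>k. ln (M k) / M k) \<longlonglongrightarrow> 0"
      by (rule filterlim_compose[OF ln_x_over_x_tendsto_0 M])
    have SP: "(S *v \<nu>) $ i = 1" if "i \<in> P" for i
    proof -
      have "(\<lambda>k. (ln (a k $ i) - ln (M k)) / M k + ln (M k) / M k) \<longlonglongrightarrow> 0 + 0"
        by (intro tendsto_add Bseq_div_tendsto_0 lnP that M lnM_M)
      then have "(\<lambda>k. ln (a k $ i) / M k) \<longlonglongrightarrow> 0"
        by (simp add: diff_divide_distrib)
      with ln_lim[of i] that P_F show ?thesis using LIMSEQ_unique by fastforce
    qed
    have i0: "i0 \<in> F" using less.prems(6) .
    have B0': "Bseq (\<lambda>k. ln (a k $ i0))" using Bseq_subseq[OF B0, of s] by (simp add: a_def)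
    have S0: "(S *v \<nu>) $ i0 = 1"
      using LIMSEQ_unique[OF ln_lim[OF i0] Bseq_div_tendsto_0[OF B0' M]] by simp
    have \<nu>i0: "\<nu> $ i0 = 0"
    proof -
      obtain b where b: "\<And>k. \<bar>ln (a k $ i0)\<bar> \<le> b" using B0' unfolding Bseq_def by auto
      have "norm (a k $ i0) \<le> exp b" for k
      proof -
        have "a k $ i0 = exp (ln (a k $ i0))" using a_pos[OF i0, of k] by simp
        also have "\<dots> \<le> exp b" using b[of k] by simp
        finally show ?thesis using a_pos[OF i0, of k] by simp
      qed
      then have "Bseq (\<lambda>k. a k $ i0)" by (rule BseqI')
      from LIMSEQ_unique[OF ai Bseq_div_tendsto_0[OF this M]] show ?thesis .
    qed
    have i0F': "i0 \<in> F'" using i0 S0 \<nu>i0 by (simp add: F'_def)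
    have "P \<noteq> {}"
    proof
      assume "P = {}"
      then have "\<nu> $ i = 0" for i using \<nu>0[of i] by (auto simp: P_def order_less_le)
      then have "\<nu> = 0" by (simp add: vec_eq_iff)
      then show False using S0 by simp
    qed
    then obtain p where "p \<in> P" by blast
    then have "p \<in> F" "p \<notin> F'" using P_F by (auto simp: F'_def P_def)
    then have "F' \<subset> F" by (auto simp: F'_def)
    then have card: "card F' < card F" by (intro psubset_card_mono) auto
    \<comment> \<open>If \<open>ln \<lambda>\<^sub>i / M\<close> had a positive limit, then \<open>\<lambda>\<^sub>i / M\<close> would not tend to \<open>0\<close>. So on these indices it
        has a negative limit and \<open>\<lambda>\<^sub>i \<rightarrow> 0\<close>.\<close>
    have rest: "Bseq (\<lambda>k. a k $ i)" if i: "i \<in> F" "i \<notin> P" "i \<notin> F'" for i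
    proof -
      have \<nu>i: "\<nu> $ i = 0" using i(2) \<nu>0[of i] by (simp add: P_def)
      have "1 - (S *v \<nu>) $ i \<le> 0"
      proof (rule LIMSEQ_le[OF ln_lim[OF i(1)] lnM_M])
        have "eventually (\<lambda>k. a k $ i / M k < 1) sequentially"
          using order_tendstoD(2)[OF ai[of i], of 1] \<nu>i by simp
        then obtain N where N: "\<And>k. k \<ge> N \<Longrightarrow> a k $ i / M k < 1"
          unfolding eventually_sequentially by blast
        have "ln (a k $ i) / M k \<le> ln (M k) / M k" if "k \<ge> N" for k
          using N[OF that] M1[of k] a_pos[OF i(1), of k]
          by (intro divide_right_mono) (auto simp: field_simps)
        then show "\<exists>N. \<forall>k\<ge>N. ln (a k $ i) / M k \<le> ln (M k) / M k" by blast
      qed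
      moreover have "(S *v \<nu>) $ i \<noteq> 1" using i \<nu>i by (simp add: F'_def)
      ultimately have "1 - (S *v \<nu>) $ i < 0" by simp
      from order_tendstoD(2)[OF ln_lim[OF i(1)] this]
      have "eventually (\<lambda>k. norm (a k $ i) \<le> norm (1::real)) sequentially"
      proof eventually_elim
        case (elim k)
        then have "ln (a k $ i) < 0" using M1[of k] by (simp add: divide_less_0_iff)
        then show ?case using a_pos[OF i(1), of k] by simp
      qed
      then show ?thesis by (rule Bseq_eventually_mono) (simp add: Bfun_const)
    qed
    obtain S' z where S': "symmetric_positive_definite S'"
      and z_ortho: "\<And>i k. i \<notin> P \<Longrightarrow> k \<in> P \<Longrightarrow> (S *v z i) $ k = 0"
      and z_out: "\<And>i k. k \<notin> P \<Longrightarrow> z i $ k = (if k = i then 1 else 0)"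
      and S'_eq: "\<And>i y. i \<notin> P \<Longrightarrow> (S' *v y) $ i = z i \<bullet> (S *v y)"
      using spd_schur_congruence[OF S, of P] by metis
    define y where "y k = (\<chi> i. if i \<in> F' then a k $ i else 0)" for k
    have zsum: "z i \<bullet> u = u $ i + (\<Sum>j\<in>P. z i $ j * u $ j)" if "i \<notin> P" for i u
    proof -
      have "z i \<bullet> u = (\<Sum>j\<in>insert i P. z i $ j * u $ j)"
        unfolding inner_vec_sum using z_out by (intro sum.mono_neutral_right) auto
      then show ?thesis using that z_out[OF that, of i] by simp
    qed
    have new: "Bseq (\<lambda>k. (S' *v y k) $ i + ln (y k $ i) - ln (M k))" if i: "i \<in> F'" for i
    proof -
      have iP: "i \<notin> P" and iF: "i \<in> F" and Si: "(S *v \<nu>) $ i = 1" using i by (auto simp: F'_def P_def)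
      have "z i \<bullet> (S *v \<nu>) = \<nu> \<bullet> (S *v z i)" by (rule spd_symmetric_form[OF S])
      also have "\<dots> = 0"
        unfolding inner_vec_sum
      proof (intro sum.neutral ballI)
        fix j show "\<nu> $ j * (S *v z i) $ j = 0"
          using z_ortho[OF iP, of j] \<nu>0[of j] by (cases "j \<in> P") (auto simp: P_def)
      qed
      finally have sum1: "(\<Sum>j\<in>P. z i $ j) = - 1"
        using zsum[OF iP, of "S *v \<nu>"] SP Si by simp
      have diff: "z i \<bullet> (S *v a k) - (S' *v y k) $ i = (\<Sum>j\<in>UNIV. (a k - y k) $ j * (S *v z i) $ j)" for k
      proof -
        have "z i \<bullet> (S *v a k) - (S' *v y k) $ i = z i \<bullet> (S *v (a k - y k))"
          by (simp add: S'_eq[OF iP] matrix_vector_mult_diff_distrib inner_diff_right)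
        also have "\<dots> = (a k - y k) \<bullet> (S *v z i)" by (rule spd_symmetric_form[OF S])
        finally show ?thesis unfolding inner_vec_sum .
      qed
      have B1: "Bseq (\<lambda>k. z i \<bullet> (S *v a k) - (S' *v y k) $ i)"
        unfolding diff
      proof (rule Bseq_sum)
        fix j
        consider "j \<in> P" | "j \<in> F'" | "j \<notin> F" | "j \<in> F" "j \<notin> P" "j \<notin> F'" by blast
        then show "Bseq (\<lambda>k. (a k - y k) $ j * (S *v z i) $ j)"
        proof cases
          case 1 then show ?thesis by (simp add: z_ortho[OF iP] Bfun_const)
        next
          case 2 then show ?thesis by (simp add: y_def Bfun_const)
        next
          case 3
          then have "j \<notin> F'" by (simp add: F'_def)
          with 3 show ?thesis by (simp add: y_def a_zero Bfun_const)
        next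
          case 4
          then have "Bseq (\<lambda>k. a k $ j * (S *v z i) $ j)"
            by (intro Bseq_mult rest Bfun_const)
          with 4 show ?thesis by (simp add: y_def)
        qed
      qed
      have B2: "Bseq (\<lambda>k. (S *v a k) $ j - M k + ln (M k))" if "j \<in> P" for j
      proof -
        have "Bseq (\<lambda>k. ((S *v a k) $ j + ln (a k $ j) - M k) - (ln (a k $ j) - ln (M k)))"
          using that P_F by (intro Bseq_diff_Bseq eqn lnP) auto
        then show ?thesis by (simp add: algebra_simps)
      qed
      have "Bseq (\<lambda>k. ((S *v a k) $ i + ln (a k $ i) - M k)
          + (\<Sum>j\<in>P. z i $ j * ((S *v a k) $ j - M k + ln (M k)))
          - (z i \<bullet> (S *v a k) - (S' *v y k) $ i))"
        by (intro Bseq_diff_Bseq Bseq_add_Bseq eqn iF Bseq_sum Bseq_mult Bfun_const B1 B2)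
      moreover have "((S *v a k) $ i + ln (a k $ i) - M k)
          + (\<Sum>j\<in>P. z i $ j * ((S *v a k) $ j - M k + ln (M k)))
          - (z i \<bullet> (S *v a k) - (S' *v y k) $ i) = (S' *v y k) $ i + ln (y k $ i) - ln (M k)" for k
      proof -
        have "(\<Sum>j\<in>P. z i $ j * ((S *v a k) $ j - M k + ln (M k)))
            = (\<Sum>j\<in>P. z i $ j * (S *v a k) $ j) + (\<Sum>j\<in>P. z i $ j) * (ln (M k) - M k)"
          unfolding sum_distrib_right sum.distrib[symmetric]
          by (intro sum.cong) (auto simp: algebra_simps)
        then show ?thesis
          unfolding zsum[OF iP] sum1 using i by (simp add: y_def)
      qed
      ultimately show ?thesis by simp
    qed
    have "\<not> Bseq (\<lambda>k. ln (y k $ i0))"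
      by (rule less.hyps[OF card S' _ _ lnM new i0F']) (auto simp: y_def F'_def a_pos)
    then show False using B0' i0F' by (simp add: y_def)
  qed
qed

section \<open>Laplace's method with large and small weights\<close>

lemma exp_remainder_nonneg: "(0::real) \<le> exp u - 1 - u"
  using exp_ge_add_one_self[of u] by linarith

text \<open>
  The tangent of slope \<open>p\<close> to the convex function \<open>e^u - 1 - u\<close>, with its intercept
  \<open>p - (1 + p) ln (1 + p)\<close> estimated by \<open>- p\<^sup>2\<close>.
\<close>
lemma exp_remainder_lower_bound:
  fixes p u :: real
  assumes "p > -1"
  shows "p * u - p\<^sup>2 \<le> exp u - 1 - u"
proof -
  let ?l = "ln (1 + p)"
  have l: "?l \<le> p" using assms by (intro ln_add_one_self_le_self2)
  have "(1 + p) * (1 + (u - ?l)) \<le> (1 + p) * exp (u - ?l)"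
    using assms exp_ge_add_one_self[of "u - ?l"] by (intro mult_left_mono) auto
  also have "\<dots> = exp u" using assms by (simp add: exp_diff)
  finally have 1: "(1 + p) * (1 + (u - ?l)) \<le> exp u" .
  have "(1 + p) * ?l \<le> (1 + p) * p" using l assms by (intro mult_left_mono) auto
  with 1 show ?thesis by (simp add: algebra_simps power2_eq_square)
qed

text \<open>
  The tangents of slope \<open>b / s\<close> and \<open>- b / s\<close>: their intercept of order \<open>s\<close> to the power \<open>-2\<close> compensates
  the factor \<open>s\<^sup>2\<close>. Hence the rescaled remainders are bounded below by a cone, uniformly in \<open>s\<close>.
\<close>
lemma scaled_exp_remainder_lower_bound:
  fixes s b v :: real
  assumes s: "s \<ge> 1" and b: "0 < b" "b < 1"
  shows "b * \<bar>v\<bar> - b\<^sup>2 \<le> s\<^sup>2 * (exp (v / s) - 1 - v / s)"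
proof -
  define e where "e = (if v \<ge> 0 then 1 else - 1 :: real)"
  have e: "e * v = \<bar>v\<bar>" "e\<^sup>2 = 1" by (auto simp: e_def)
  have "b / s \<le> b" using s b by (simp add: field_simps)
  then have "e * b / s > -1" using s b by (auto simp: e_def field_simps)
  from exp_remainder_lower_bound[OF this, of "v / s"]
  have "s\<^sup>2 * (e * b / s * (v / s) - (e * b / s)\<^sup>2) \<le> s\<^sup>2 * (exp (v / s) - 1 - v / s)"
    by (rule mult_left_mono) simp
  moreover have "s\<^sup>2 * (e * b / s * (v / s) - (e * b / s)\<^sup>2) = b * (e * v) - e\<^sup>2 * b\<^sup>2"
    using s by (simp add: field_simps power2_eq_square)
  ultimately show ?thesis by (simp add: e)
qed

lemma scaled_exp_remainder_tendsto:
  fixes v :: real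
  shows "((\<lambda>t. t * (exp (v / sqrt t) - 1 - v / sqrt t)) \<longlongrightarrow> v\<^sup>2 / 2) at_top"
  unfolding power2_eq_square by real_asymp

text \<open>
  The constant \<open>1\<close> in the exponent matches the majorant used in \<open>laplace_integral_tendsto\<close>.
\<close>
lemma nn_integral_exp_neg_abs_finite:
  fixes b :: real
  assumes b: "b > 0"
  shows "(\<integral>\<^sup>+t. ennreal (exp (1 - b * \<bar>t\<bar>)) \<partial>lborel) < \<infinity>"
proof -
  let ?h = "\<lambda>t::real. ennreal (exp (1 - b * t)) * indicator {0..} t"
  have "(\<integral>\<^sup>+t. ?h t \<partial>lborel) = ennreal (0 - (- exp (1 - b * 0) / b))"
  proof (rule nn_integral_FTC_atLeast)
    show "((\<lambda>t. - exp (1 - b * t) / b) \<longlongrightarrow> 0) at_top"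
      using b by real_asymp
    show "((\<lambda>t. - exp (1 - b * t) / b) has_real_derivative exp (1 - b * t)) (at t)" for t
      using b by (auto intro!: derivative_eq_intros)
  qed auto
  then have fin: "(\<integral>\<^sup>+t. ?h t \<partial>lborel) < \<infinity>" by simp
  have "(\<integral>\<^sup>+t. ?h t \<partial>lborel) = ennreal \<bar>-1\<bar> * (\<integral>\<^sup>+t. ?h (0 + (-1) * t) \<partial>lborel)"
    by (rule nn_integral_real_affine) auto
  then have refl: "(\<integral>\<^sup>+t. ?h (- t) \<partial>lborel) < \<infinity>" using fin by simp
  have "(\<integral>\<^sup>+t. ennreal (exp (1 - b * \<bar>t\<bar>)) \<partial>lborel) \<le> (\<integral>\<^sup>+t. ?h t + ?h (- t) \<partial>lborel)"
    by (intro nn_integral_mono) (auto simp: indicator_def)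
  also have "\<dots> = (\<integral>\<^sup>+t. ?h t \<partial>lborel) + (\<integral>\<^sup>+t. ?h (- t) \<partial>lborel)"
    by (rule nn_integral_add) measurable
  also have "\<dots> < \<infinity>" using fin refl by simp
  finally show ?thesis .
qed

lemma integrable_prod_exp_neg_abs:
  fixes b :: real
  assumes b: "b > 0"
  shows "integrable lborel (\<lambda>v::real^'n. exp (\<Sum>i\<in>UNIV. 1 - b * \<bar>v $ i\<bar>))"
proof (rule integrableI_nonneg)
  have "(\<integral>\<^sup>+v. ennreal (exp (\<Sum>i\<in>UNIV. 1 - b * \<bar>v $ i\<bar>)) \<partial>(lborel :: (real^'n) measure))
      = (\<integral>\<^sup>+v. (\<Prod>i\<in>UNIV. ennreal (exp (1 - b * \<bar>v $ i\<bar>))) \<partial>(lborel :: (real^'n) measure))"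
    by (simp add: exp_sum prod_ennreal)
  also have "\<dots> = (\<Prod>i\<in>(UNIV :: 'n set). \<integral>\<^sup>+t. ennreal (exp (1 - b * \<bar>t\<bar>)) \<partial>lborel)"
    by (rule nn_integral_lborel_vec_prod) measurable
  also have "\<dots> < \<infinity>"
    using nn_integral_exp_neg_abs_finite[OF b] by (simp add: power_less_top_ennreal)
  finally show "(\<integral>\<^sup>+v. ennreal (exp (\<Sum>i\<in>UNIV. 1 - b * \<bar>v $ i\<bar>)) \<partial>(lborel :: (real^'n) measure)) < \<infinity>" .
qed (auto intro!: borel_measurable_continuous_onI continuous_intros)

lemma integral_rescale:
  fixes f :: "real^'n \<Rightarrow> real"
  assumes A: "rescales_lborel A" and f [measurable]: "f \<in> borel_measurable borel"
    and nn: "\<And>x. f x \<ge> 0"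
  shows "(LINT x|lborel. f x) = \<bar>det A\<bar> * (LINT x|lborel. f (A *v x))"
proof -
  have "(\<integral>\<^sup>+x. ennreal (f x) \<partial>lborel) = ennreal \<bar>det A\<bar> * (\<integral>\<^sup>+x. ennreal (f (A *v x)) \<partial>lborel)"
    using A unfolding rescales_lborel_def by (rule bspec) measurable
  moreover have "(LINT x|lborel. f x) = enn2real (\<integral>\<^sup>+x. ennreal (f x) \<partial>lborel)"
    by (rule integral_eq_nn_integral) (auto simp: nn)
  moreover have "(LINT x|lborel. f (A *v x)) = enn2real (\<integral>\<^sup>+x. ennreal (f (A *v x)) \<partial>lborel)"
    by (rule integral_eq_nn_integral) (auto simp: nn)
  ultimately show ?thesis by (simp add: enn2real_mult)
qed

lemma tendsto_det:
  fixes B :: "'a \<Rightarrow> real^'n^'n"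
  assumes "\<And>i j. ((\<lambda>k. B k $ i $ j) \<longlongrightarrow> M $ i $ j) F"
  shows "((\<lambda>k. det (B k)) \<longlongrightarrow> det M) F"
  unfolding det_def by (intro tendsto_intros assms)

lemma inner_matrix_vector_sum:
  "(x::real^'n) \<bullet> (A *v y) = (\<Sum>i\<in>UNIV. \<Sum>j\<in>UNIV. x $ i * A $ i $ j * y $ j)"
  by (simp add: inner_vec_def matrix_vector_mult_def sum_distrib_left mult.assoc)

text \<open>
  The limit of \<open>D + \<Lambda>\<close> after scaling both sides by the inverse square roots of the large weights, those with
  index in \<open>P\<close>, while the other weights tend to \<open>0\<close>.
\<close>
definition block_limit :: "'n set \<Rightarrow> real^'n^'n \<Rightarrow> real^'n^'n" where
  "block_limit P D = (\<chi> i j. if i \<in> P \<or> j \<in> P then (if i = j then 1 else 0) else D $ i $ j)"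

lemma spd_block_limit:
  fixes D :: "real^'n^'n"
  assumes D: "symmetric_positive_definite D"
  shows "symmetric_positive_definite (block_limit P D)"
proof -
  define res :: "real^'n \<Rightarrow> real^'n" where "res x = (\<chi> i. if i \<in> P then 0 else x $ i)" for x
  have form: "x \<bullet> (block_limit P D *v y) = (\<Sum>i\<in>P. x $ i * y $ i) + res x \<bullet> (D *v res y)" for x y
  proof -
    have "(block_limit P D *v y) $ i = (if i \<in> P then y $ i else (D *v res y) $ i)" for i
    proof (cases "i \<in> P")
      case True
      then show ?thesis
        by (simp add: block_limit_def matrix_vector_mult_def if_distrib[of "\<lambda>t. t * _"] cong: if_cong)
    next
      case False
      then have "(if i \<in> P \<or> j \<in> P then if i = j then 1 else 0 else D $ i $ j) * y $ j =
          D $ i $ j * (if j \<in> P then 0 else y $ j)" for j by auto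
      with False show ?thesis by (simp add: block_limit_def matrix_vector_mult_def res_def)
    qed
    then have "x \<bullet> (block_limit P D *v y) =
        (\<Sum>i\<in>UNIV. (if i \<in> P then x $ i * y $ i else 0) + res x $ i * (D *v res y) $ i)"
      unfolding inner_vec_def by (intro sum.cong) (auto simp: res_def)
    then show ?thesis
      by (simp add: sum.distrib inner_vec_def sum.If_cases)
  qed
  have "x \<bullet> (block_limit P D *v x) > 0" if "x \<noteq> 0" for x
  proof -
    have sq: "(\<Sum>i\<in>P. x $ i * x $ i) \<ge> 0" by (intro sum_nonneg) auto
    show ?thesis
    proof (cases "res x = 0")
      case False
      then have "res x \<bullet> (D *v res x) > 0" using D by (simp add: symmetric_positive_definite_def)
      with sq show ?thesis unfolding form by linarith
    next
      case True
      then have out: "x $ i = 0" if "i \<notin> P" for i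
      proof -
        have "res x $ i = 0" using True by simp
        with that show ?thesis by (simp add: res_def)
      qed
      have "(\<Sum>i\<in>P. x $ i * x $ i) = x \<bullet> x"
        unfolding inner_vec_def using out by (intro sum.mono_neutral_cong_left) auto
      with that True show ?thesis unfolding form by simp
    qed
  qed
  moreover have "x \<bullet> (block_limit P D *v y) = y \<bullet> (block_limit P D *v x)" for x y
    unfolding form using spd_symmetric_form[OF D, of "res x" "res y"] by (simp add: mult.commute)
  ultimately show ?thesis unfolding spd_iff_form by blast
qed

text \<open>
  Substitute \<open>u\<^sub>i = v\<^sub>i / sqrt \<lambda>\<^sub>i\<close> for \<open>i \<in> P\<close>. The quadratic part of the exponent is then given by
  the matrix \<open>B k\<close>, which converges to \<open>block_limit P D\<close>; the differences
  \<open>\<lambda>\<^sub>i (e^u\<^sub>i - 1 - u\<^sub>i - u\<^sub>i\<^sup>2 / 2)\<close> tend to \<open>0\<close>, for \<open>i \<in> P\<close> by Taylor expansion and for the other \<open>i\<close>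
  because the weight does. Dominated convergence applies with a majorant of the form
  \<open>exp (\<Sum>\<^sub>i (1 - b |v\<^sub>i|))\<close>: a coordinate in \<open>P\<close> is controlled by the remainder of the exponential
  function, any other one by the form \<open>D\<close>. The Jacobian is absorbed into \<open>det (B k)\<close>.
\<close>
proposition laplace_integral_tendsto:
  fixes D :: "real^'n^'n" and lam :: "nat \<Rightarrow> real^'n"
  assumes D: "symmetric_positive_definite D"
    and pos: "\<And>k i. lam k $ i > 0"
    and ge1: "\<And>k i. i \<in> P \<Longrightarrow> lam k $ i \<ge> 1"
    and inf: "\<And>i. i \<in> P \<Longrightarrow> filterlim (\<lambda>k. lam k $ i) at_top sequentially"
    and zero: "\<And>i. i \<notin> P \<Longrightarrow> (\<lambda>k. lam k $ i) \<longlonglongrightarrow> 0"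
  shows "(\<lambda>k. sqrt (det (D + diag_matrix (($) (lam k)))) *
      (LINT u|lborel. exp (- (\<Sum>i\<in>UNIV. lam k $ i * (exp (u $ i) - 1 - u $ i)) - 1 / 2 * (u \<bullet> (D *v u)))))
    \<longlonglongrightarrow> sqrt ((2 * pi) ^ CARD('n))"
proof -
  define r where "r k i = (if i \<in> P then 1 / sqrt (lam k $ i) else 1)" for k i
  define R where "R k = diag_matrix (r k)" for k
  define B where "B k = R k ** (D + diag_matrix (($) (lam k))) ** R k" for k
  define M where "M = block_limit P D"
  define G where "G k u = exp (- (\<Sum>i\<in>UNIV. lam k $ i * (exp (u $ i) - 1 - u $ i)) - 1 / 2 * (u \<bullet> (D *v u)))"
    for k and u :: "real^'n"
  have r_pos: "r k i > 0" for k i using pos by (simp add: r_def)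
  have Rv: "(R k *v v) $ i = r k i * v $ i" for k v i by (simp add: R_def diag_matrix_mult)
  have r_lim: "(\<lambda>k. r k i) \<longlonglongrightarrow> (if i \<in> P then 0 else 1)" for i
  proof (cases "i \<in> P")
    case True
    have "(\<lambda>k. inverse (sqrt (lam k $ i))) \<longlonglongrightarrow> 0"
      by (rule tendsto_inverse_0_at_top[OF filterlim_compose[OF sqrt_at_top inf[OF True]]])
    with True show ?thesis by (simp add: r_def inverse_eq_divide)
  qed (simp add: r_def)
  have rr: "(r k i)\<^sup>2 * lam k $ i = 1" if "i \<in> P" for k i
    using that pos[of k i] by (simp add: r_def power_divide)
  have B: "B k $ i $ j = r k i * r k j * D $ i $ j + (if i = j then (r k i)\<^sup>2 * lam k $ i else 0)" for k i j
    unfolding B_def R_def diag_matrix_mult_left diag_matrix_mult_right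
    by (simp add: diag_matrix_def algebra_simps power2_eq_square)
  have B_lim: "(\<lambda>k. B k $ i $ j) \<longlonglongrightarrow> M $ i $ j" for i j
  proof -
    let ?l = "\<lambda>i. if i \<in> P then 0 else (1::real)"
    have d: "(\<lambda>k. if i = j then (r k i)\<^sup>2 * lam k $ i else 0) \<longlonglongrightarrow> (if i = j \<and> i \<in> P then 1 else 0)"
    proof (cases "i \<in> P")
      case True
      then have "(\<lambda>k. (r k i)\<^sup>2 * lam k $ i) \<longlonglongrightarrow> 1" by (simp add: rr)
      with True show ?thesis by (cases "i = j") simp_all
    next
      case False
      then have "(\<lambda>k. (r k i)\<^sup>2 * lam k $ i) \<longlonglongrightarrow> 0" using zero[OF False] by (simp add: r_def)
      with False show ?thesis by (cases "i = j") simp_all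
    qed
    have "(\<lambda>k. B k $ i $ j) \<longlonglongrightarrow> ?l i * ?l j * D $ i $ j + (if i = j \<and> i \<in> P then 1 else 0)"
      unfolding B by (intro tendsto_intros r_lim d)
    also have "?l i * ?l j * D $ i $ j + (if i = j \<and> i \<in> P then 1 else 0) = M $ i $ j"
      by (auto simp: M_def block_limit_def)
    finally show ?thesis .
  qed
  have G_meas: "G k \<in> borel_measurable borel" for k
    unfolding G_def by (intro borel_measurable_continuous_onI continuous_intros)
  have quad: "v \<bullet> (B k *v v) = (R k *v v) \<bullet> (D *v (R k *v v)) + (\<Sum>i\<in>UNIV. lam k $ i * (r k i * v $ i)\<^sup>2)" for k v
  proof -
    have "v \<bullet> (B k *v v) = (R k *v v) \<bullet> ((D + diag_matrix (($) (lam k))) *v (R k *v v))"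
    proof -
      have "v \<bullet> (R k *v w) = (R k *v v) \<bullet> w" for w
        by (simp add: inner_vec_def Rv mult_ac)
      then show ?thesis by (simp add: B_def matrix_vector_mul_assoc[symmetric])
    qed
    then show ?thesis
      by (simp add: matrix_vector_mult_add_rdistrib inner_add_right inner_diag_matrix
          Rv power2_eq_square mult_ac)
  qed
  have G_R: "G k (R k *v v) = exp (- (\<Sum>i\<in>UNIV. lam k $ i * (exp (r k i * v $ i) - 1 - r k i * v $ i)
      - lam k $ i * (r k i * v $ i)\<^sup>2 / 2) - 1 / 2 * (v \<bullet> (B k *v v)))" for k v
  proof -
    have "- a - 1 / 2 * b = - (a - c / 2) - 1 / 2 * (b + c)" for a b c :: real
      by (simp add: field_simps)
    then show ?thesis
      unfolding G_def quad Rv sum_divide_distrib[symmetric]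
        sum_subtractf[of "\<lambda>i. lam k $ i * (exp (r k i * v $ i) - 1 - r k i * v $ i)"]
      by (intro arg_cong[where f = exp])
  qed
  have G_lim: "(\<lambda>k. G k (R k *v v)) \<longlonglongrightarrow> exp (- 1 / 2 * (v \<bullet> (M *v v)))" for v
  proof -
    have t: "(\<lambda>k. lam k $ i * (exp (r k i * v $ i) - 1 - r k i * v $ i) - lam k $ i * (r k i * v $ i)\<^sup>2 / 2)
        \<longlonglongrightarrow> 0" for i
    proof (cases "i \<in> P")
      case True
      have "(\<lambda>k. lam k $ i * (exp (v $ i / sqrt (lam k $ i)) - 1 - v $ i / sqrt (lam k $ i)) - (v $ i)\<^sup>2 / 2)
          \<longlonglongrightarrow> (v $ i)\<^sup>2 / 2 - (v $ i)\<^sup>2 / 2"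
        by (intro tendsto_diff tendsto_const filterlim_compose[OF scaled_exp_remainder_tendsto inf[OF True]])
      moreover have "lam k $ i * (r k i * v $ i)\<^sup>2 = (v $ i)\<^sup>2" for k
        using rr[OF True, of k] by (simp add: power_mult_distrib mult.assoc[symmetric] mult.commute)
      ultimately show ?thesis using True by (simp add: r_def)
    next
      case False
      have "(\<lambda>k. lam k $ i * (exp (v $ i) - 1 - v $ i) - lam k $ i * (v $ i)\<^sup>2 / 2)
          \<longlonglongrightarrow> 0 * (exp (v $ i) - 1 - v $ i) - 0 * (v $ i)\<^sup>2 / 2"
        by (intro tendsto_intros zero[OF False]) auto
      then show ?thesis using False by (simp add: r_def)
    qed
    have "(\<lambda>k. G k (R k *v v)) \<longlonglongrightarrow> exp (- (\<Sum>i\<in>(UNIV::'n set). 0) - 1 / 2 * (v \<bullet> (M *v v)))"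
      unfolding G_R inner_matrix_vector_sum by (intro tendsto_intros t B_lim)
    then show ?thesis by simp
  qed
  obtain c where c: "c > 0" "\<And>x. c * (norm x)\<^sup>2 \<le> x \<bullet> (D *v x)" by (rule spd_coercive[OF D]) blast
  \<comment> \<open>The slope of the cone below the exponent: small enough for the remainder bound and for \<open>D\<close>.\<close>
  define b where "b = min (1 / 2) c"
  have b: "0 < b" "b < 1" "b \<le> c" "b \<le> 1 / 2" using c by (auto simp: b_def)
  have term_bound: "b * \<bar>v\<bar> - 1 \<le> lam k $ i * (exp (r k i * v) - 1 - r k i * v) + c / 2 * (r k i * v)\<^sup>2" for k i v
  proof (cases "i \<in> P")
    case True
    have "b\<^sup>2 \<le> 1" using b by (simp add: power_le_one)
    then have "b * \<bar>v\<bar> - 1 \<le> b * \<bar>v\<bar> - b\<^sup>2" by simp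
    also have "\<dots> \<le> (sqrt (lam k $ i))\<^sup>2 * (exp (v / sqrt (lam k $ i)) - 1 - v / sqrt (lam k $ i))"
      using ge1[OF True, of k] b by (intro scaled_exp_remainder_lower_bound) auto
    also have "\<dots> = lam k $ i * (exp (r k i * v) - 1 - r k i * v)"
      using True pos[of k i] by (simp add: r_def)
    also have "\<dots> \<le> \<dots> + c / 2 * (r k i * v)\<^sup>2" using c(1) by simp
    finally show ?thesis .
  next
    case False
    have "0 \<le> (\<bar>v\<bar> - 1)\<^sup>2" by simp
    then have "\<bar>v\<bar> \<le> (v\<^sup>2 + 1) / 2" by (simp add: power2_diff)
    then have "b * \<bar>v\<bar> \<le> b * ((v\<^sup>2 + 1) / 2)" using b by (intro mult_left_mono) auto
    also have "\<dots> \<le> c / 2 * v\<^sup>2 + 1"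
    proof -
      have "b * v\<^sup>2 \<le> c * v\<^sup>2" using b by (intro mult_right_mono) auto
      then show ?thesis using b by (simp add: field_simps)
    qed
    finally have "b * \<bar>v\<bar> - 1 \<le> c / 2 * v\<^sup>2" by simp
    moreover have "0 \<le> lam k $ i * (exp v - 1 - v)"
      using pos[of k i] exp_remainder_nonneg[of v] by (intro mult_nonneg_nonneg) auto
    ultimately show ?thesis using False by (simp add: r_def)
  qed
  have G_bound: "G k (R k *v v) \<le> exp (\<Sum>i\<in>UNIV. 1 - b * \<bar>v $ i\<bar>)" for k v
  proof -
    have "(\<Sum>i\<in>UNIV. b * \<bar>v $ i\<bar> - 1) \<le> (\<Sum>i\<in>UNIV. lam k $ i * (exp (r k i * v $ i) - 1 - r k i * v $ i)
        + c / 2 * (r k i * v $ i)\<^sup>2)"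
      by (intro sum_mono term_bound)
    also have "\<dots> = (\<Sum>i\<in>UNIV. lam k $ i * (exp (r k i * v $ i) - 1 - r k i * v $ i))
        + 1 / 2 * (c * (norm (R k *v v))\<^sup>2)"
      unfolding power2_norm_eq_inner inner_vec_def
      by (simp add: sum.distrib sum_distrib_left Rv power2_eq_square mult_ac)
    also have "\<dots> \<le> (\<Sum>i\<in>UNIV. lam k $ i * (exp (r k i * v $ i) - 1 - r k i * v $ i))
        + 1 / 2 * ((R k *v v) \<bullet> (D *v (R k *v v)))"
      using c(2)[of "R k *v v"] by simp
    finally show ?thesis
      unfolding G_def by (simp add: Rv sum_subtractf)
  qed
  have det_lim: "(\<lambda>k. det (B k)) \<longlonglongrightarrow> det M" by (intro tendsto_det B_lim)
  have int_lim: "(\<lambda>k. LINT v|lborel. G k (R k *v v)) \<longlonglongrightarrow> (LINT v|lborel. exp (- 1 / 2 * (v \<bullet> (M *v v))))"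
  proof (rule integral_dominated_convergence[where w = "\<lambda>v. exp (\<Sum>i\<in>UNIV. 1 - b * \<bar>v $ i\<bar>)"])
    show "(\<lambda>v. exp (- 1 / 2 * (v \<bullet> (M *v v)))) \<in> borel_measurable lborel"
      unfolding measurable_lborel2 by (intro borel_measurable_continuous_onI continuous_intros)
    show "(\<lambda>v. G k (R k *v v)) \<in> borel_measurable lborel" for k
      unfolding measurable_lborel2 by (rule measurable_compose[OF _ G_meas]) measurable
    show "integrable lborel (\<lambda>v::real^'n. exp (\<Sum>i\<in>UNIV. 1 - b * \<bar>v $ i\<bar>))"
      by (rule integrable_prod_exp_neg_abs[OF b(1)])
    show "AE v in lborel. (\<lambda>k. G k (R k *v v)) \<longlonglongrightarrow> exp (- 1 / 2 * (v \<bullet> (M *v v)))"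
      using G_lim by simp
    show "AE v in lborel. norm (G k (R k *v v)) \<le> exp (\<Sum>i\<in>UNIV. 1 - b * \<bar>v $ i\<bar>)" for k
      using G_bound[of k] by (simp add: G_def[of k "_ *v _"])
  qed
  have "(\<lambda>k. sqrt (det (B k)) * (LINT v|lborel. G k (R k *v v)))
      \<longlonglongrightarrow> sqrt (det M) * (LINT v|lborel. exp (- 1 / 2 * (v \<bullet> (M *v v))))"
    by (intro tendsto_intros det_lim int_lim)
  also have "sqrt (det M) * (LINT v|lborel. exp (- 1 / 2 * (v \<bullet> (M *v v)))) = sqrt ((2 * pi) ^ CARD('n))"
    unfolding M_def by (rule gaussian_integral(2)[OF spd_block_limit[OF D]])
  also have "(\<lambda>k. sqrt (det (B k)) * (LINT v|lborel. G k (R k *v v))) =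
      (\<lambda>k. sqrt (det (D + diag_matrix (($) (lam k)))) * (LINT u|lborel. G k u))"
  proof
    fix k
    have resc: "rescales_lborel (R k)"
      unfolding R_def using r_pos[of k] by (intro rescales_lborel_diag_matrix) (metis less_irrefl)
    have "det (R k) > 0" unfolding R_def det_diag_matrix using r_pos by (intro prod_pos) auto
    then have "sqrt (det (B k)) = sqrt (det (D + diag_matrix (($) (lam k)))) * \<bar>det (R k)\<bar>"
      by (simp add: B_def det_mul real_sqrt_mult mult_ac)
    moreover have "(LINT u|lborel. G k u) = \<bar>det (R k)\<bar> * (LINT v|lborel. G k (R k *v v))"
      by (rule integral_rescale[OF resc G_meas]) (simp add: G_def)
    ultimately show "sqrt (det (B k)) * (LINT v|lborel. G k (R k *v v)) =
        sqrt (det (D + diag_matrix (($) (lam k)))) * (LINT u|lborel. G k u)" by simp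
  qed
  finally show ?thesis unfolding G_def .
qed

section \<open>Expansion around the minimiser\<close>

lemma continuous_on_h: "continuous_on A (h \<mu> \<Sigma> \<theta>)"
  unfolding h_def by (intro continuous_intros)

lemma h_shift_coordinate:
  fixes \<mu> :: "real^'n"
  assumes "symmetric_positive_definite \<Sigma>"
  shows "h \<mu> \<Sigma> \<theta> (y + t *\<^sub>R axis i 1) = h \<mu> \<Sigma> \<theta> y + \<theta> * exp (\<mu> $ i + y $ i) * (exp t - 1)
    + t * (matrix_inv \<Sigma> *v y) $ i + t\<^sup>2 * (matrix_inv \<Sigma> $ i $ i / 2)"
proof -
  let ?D = "matrix_inv \<Sigma>" and ?e = "axis i 1 :: real^'n"
  have "?e \<bullet> (?D *v y) = y \<bullet> (?D *v ?e)"
    by (rule spd_symmetric_form[OF spd_matrix_inv[OF assms]])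
  moreover have "?e \<bullet> (?D *v z) = (?D *v z) $ i" for z by (simp add: inner_axis')
  moreover have "(?D *v ?e) $ i = ?D $ i $ i" by (simp add: matrix_vector_mul_component inner_axis)
  ultimately have quad: "(y + t *\<^sub>R ?e) \<bullet> (?D *v (y + t *\<^sub>R ?e)) =
      y \<bullet> (?D *v y) + 2 * t * (?D *v y) $ i + t\<^sup>2 * ?D $ i $ i"
    by (simp add: matrix_vector_right_distrib matrix_vector_mult_scaleR inner_add_left inner_add_right
        power2_eq_square distrib_left)
  have "exp (\<mu> $ j + (y + t *\<^sub>R ?e) $ j) = exp (\<mu> $ j + y $ j) +
      (if j = i then exp (\<mu> $ i + y $ i) * (exp t - 1) else 0)" for j
    by (simp add: axis_def exp_add algebra_simps)
  then have "(\<Sum>j\<in>UNIV. exp (\<mu> $ j + (y + t *\<^sub>R ?e) $ j)) =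
      (\<Sum>j\<in>UNIV. exp (\<mu> $ j + y $ j)) + exp (\<mu> $ i + y $ i) * (exp t - 1)"
    by (simp add: sum.distrib)
  then show ?thesis unfolding h_def quad by (simp only:) (simp add: algebra_simps)
qed

text \<open>
  At a stationary point the linear terms cancel, which leaves the remainder of the exponential
  function and the quadratic form. For \<open>\<theta> > 0\<close> both are nonnegative, so a stationary point is the
  strict global minimiser.
\<close>
lemma h_stationary_expansion:
  fixes \<mu> :: "real^'n"
  assumes "symmetric_positive_definite \<Sigma>"
    and stat: "\<And>i. (matrix_inv \<Sigma> *v y) $ i = - (\<theta> * exp (\<mu> $ i + y $ i))"
  shows "h \<mu> \<Sigma> \<theta> (y + u) = h \<mu> \<Sigma> \<theta> y
    + (\<Sum>i\<in>UNIV. \<theta> * exp (\<mu> $ i + y $ i) * (exp (u $ i) - 1 - u $ i)) + 1 / 2 * (u \<bullet> (matrix_inv \<Sigma> *v u))"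
proof -
  let ?D = "matrix_inv \<Sigma>"
  have "y \<bullet> (?D *v u) = u \<bullet> (?D *v y)"
    by (rule spd_symmetric_form[OF spd_matrix_inv[OF assms(1)]])
  then have quad: "(y + u) \<bullet> (?D *v (y + u)) = y \<bullet> (?D *v y) + 2 * (u \<bullet> (?D *v y)) + u \<bullet> (?D *v u)"
    by (simp add: matrix_vector_right_distrib inner_add_left inner_add_right)
  have lin: "u \<bullet> (?D *v y) = - (\<Sum>i\<in>UNIV. \<theta> * exp (\<mu> $ i + y $ i) * u $ i)"
    unfolding inner_vec_def stat by (simp add: sum_negf mult_ac)
  have "\<theta> * (\<Sum>i\<in>UNIV. exp (\<mu> $ i + (y + u) $ i)) = (\<Sum>i\<in>UNIV. \<theta> * exp (\<mu> $ i + y $ i) * exp (u $ i))"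
    by (simp add: sum_distrib_left exp_add mult_ac)
  moreover have "(\<Sum>i\<in>UNIV. \<theta> * exp (\<mu> $ i + y $ i) * (exp (u $ i) - 1 - u $ i)) =
      (\<Sum>i\<in>UNIV. \<theta> * exp (\<mu> $ i + y $ i) * exp (u $ i)) - \<theta> * (\<Sum>i\<in>UNIV. exp (\<mu> $ i + y $ i))
      - (\<Sum>i\<in>UNIV. \<theta> * exp (\<mu> $ i + y $ i) * u $ i)"
    by (simp add: sum_distrib_left sum_subtractf[symmetric] algebra_simps)
  ultimately show ?thesis unfolding h_def quad lin by simp
qed

text \<open>
  A minimum exists by coercivity of the quadratic form. It is stationary in every coordinate direction and
  hence unique, so the definite description in \<open>xstar\<close> denotes it.
\<close>
lemma xstar_stationary:
  fixes \<mu> :: "real^'n"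
  assumes S: "symmetric_positive_definite \<Sigma>" and \<theta>: "\<theta> > 0"
  shows "(matrix_inv \<Sigma> *v xstar \<mu> \<Sigma> \<theta>) $ i = - (\<theta> * exp (\<mu> $ i + xstar \<mu> \<Sigma> \<theta> $ i))"
proof -
  let ?D = "matrix_inv \<Sigma>" and ?h = "h \<mu> \<Sigma> \<theta>"
  have D: "symmetric_positive_definite ?D" by (rule spd_matrix_inv[OF S])
  obtain c where c: "c > 0" "\<And>x. c * (norm x)\<^sup>2 \<le> x \<bullet> (?D *v x)" by (rule spd_coercive[OF D]) blast
  have h_ge: "?h x \<ge> c / 2 * (norm x)\<^sup>2" for x
  proof -
    have "\<theta> * (\<Sum>i\<in>UNIV. exp (\<mu> $ i + x $ i)) \<ge> 0"
      using \<theta> by (intro mult_nonneg_nonneg sum_nonneg) auto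
    then show ?thesis using c(2)[of x] by (simp add: h_def)
  qed
  \<comment> \<open>Outside the ball of radius \<open>\<rho>\<close> the quadratic form alone exceeds \<open>h 0\<close>.\<close>
  define \<rho> where "\<rho> = 2 * ?h 0 / c + 1"
  have h0: "?h 0 \<ge> 0" using h_ge[of 0] by simp
  then have \<rho>: "\<rho> \<ge> 1" using c by (simp add: \<rho>_def)
  have "\<exists>y\<in>cball 0 \<rho>. \<forall>x\<in>cball 0 \<rho>. ?h y \<le> ?h x"
    using \<rho> by (intro continuous_attains_inf continuous_on_h) auto
  then obtain y where y: "y \<in> cball 0 \<rho>" "\<And>x. x \<in> cball 0 \<rho> \<Longrightarrow> ?h y \<le> ?h x" by blast
  have min: "?h y \<le> ?h x" for x
  proof (cases "x \<in> cball 0 \<rho>")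
    case False
    then have "\<rho> \<le> norm x" by simp
    then have "1 * \<rho> \<le> norm x * norm x" using \<rho> by (intro mult_mono) auto
    then have "c / 2 * \<rho> \<le> c / 2 * (norm x)\<^sup>2"
      using c(1) by (intro mult_left_mono) (auto simp: power2_eq_square)
    moreover have "c / 2 * \<rho> = ?h 0 + c / 2" using c(1) by (simp add: \<rho>_def field_simps)
    ultimately have "?h 0 \<le> ?h x" using h_ge[of x] c(1) by linarith
    moreover have "?h y \<le> ?h 0" using \<rho> by (intro y) auto
    ultimately show ?thesis by linarith
  qed (rule y)
  have stat: "(?D *v y) $ i = - (\<theta> * exp (\<mu> $ i + y $ i))" for i
  proof -
    let ?f = "\<lambda>t. ?h y + \<theta> * exp (\<mu> $ i + y $ i) * (exp t - 1) + t * (?D *v y) $ i + t\<^sup>2 * (?D $ i $ i / 2)"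
    have "(?f has_real_derivative \<theta> * exp (\<mu> $ i + y $ i) + (?D *v y) $ i) (at 0)"
      by (auto intro!: derivative_eq_intros)
    moreover have "\<forall>t. \<bar>0 - t\<bar> < 1 \<longrightarrow> ?f 0 \<le> ?f t"
      using min h_shift_coordinate[OF S, of \<mu> \<theta> y _ i, symmetric] by simp
    ultimately have "\<theta> * exp (\<mu> $ i + y $ i) + (?D *v y) $ i = 0"
      by (rule DERIV_local_min[OF _ zero_less_one])
    then show ?thesis by linarith
  qed
  have strict: "?h y < ?h x" if "x \<noteq> y" for x
  proof -
    have "(x - y) \<bullet> (?D *v (x - y)) > 0"
      using D that by (simp add: symmetric_positive_definite_def)
    moreover have "(\<Sum>i\<in>UNIV. \<theta> * exp (\<mu> $ i + y $ i) * (exp ((x - y) $ i) - 1 - (x - y) $ i)) \<ge> 0"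
      using \<theta> by (intro sum_nonneg mult_nonneg_nonneg exp_remainder_nonneg) auto
    ultimately show ?thesis
      using h_stationary_expansion[OF S stat, of "x - y"] by simp
  qed
  have "xstar \<mu> \<Sigma> \<theta> = y"
    unfolding xstar_def
  proof (rule the_equality)
    show "is_arg_min ?h (\<lambda>_. True) y" using min by (simp add: is_arg_min_def not_less)
    show "x = y" if "is_arg_min ?h (\<lambda>_. True) x" for x
      using that strict[of x] by (auto simp: is_arg_min_def)
  qed
  with stat show ?thesis by simp
qed

definition Lam_diag :: "real^'n \<Rightarrow> real^'n^'n \<Rightarrow> real \<Rightarrow> real^'n" where
  "Lam_diag \<mu> \<Sigma> \<theta> = (\<chi> i. \<theta> * exp (\<mu> $ i + xstar \<mu> \<Sigma> \<theta> $ i))"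

lemma Lam_diag_pos: "\<theta> > 0 \<Longrightarrow> Lam_diag \<mu> \<Sigma> \<theta> $ i > 0"
  by (simp add: Lam_diag_def)

text \<open>
  The stationarity condition \<open>D x\<^sup>* = -\<lambda>\<close> gives \<open>x\<^sup>* = - \<Sigma> \<lambda>\<close>; insert this into
  \<open>ln \<lambda>\<^sub>i = ln \<theta> + \<mu>\<^sub>i + x\<^sup>*\<^sub>i\<close>.
\<close>
lemma Lam_diag_log_equation:
  fixes \<mu> :: "real^'n"
  assumes S: "symmetric_positive_definite \<Sigma>" and \<theta>: "\<theta> > 0"
  shows "(\<Sigma> *v Lam_diag \<mu> \<Sigma> \<theta>) $ i + ln (Lam_diag \<mu> \<Sigma> \<theta> $ i) - ln \<theta> = \<mu> $ i"
proof -
  have "matrix_inv \<Sigma> *v xstar \<mu> \<Sigma> \<theta> = - Lam_diag \<mu> \<Sigma> \<theta>"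
    by (simp add: vec_eq_iff Lam_diag_def xstar_stationary[OF S \<theta>])
  then have "\<Sigma> *v (matrix_inv \<Sigma> *v xstar \<mu> \<Sigma> \<theta>) = - (\<Sigma> *v Lam_diag \<mu> \<Sigma> \<theta>)"
    using matrix_vector_mult_diff_distrib[of \<Sigma> 0 "Lam_diag \<mu> \<Sigma> \<theta>"] by simp
  then have "\<Sigma> *v Lam_diag \<mu> \<Sigma> \<theta> = - xstar \<mu> \<Sigma> \<theta>"
    by (simp add: matrix_vector_mul_assoc mult_matrix_inv[OF spd_invertible[OF S]] equation_minus_iff)
  then show ?thesis using \<theta> by (simp add: Lam_diag_def ln_mult)
qed

definition laplace_correction :: "real^'n \<Rightarrow> real^'n^'n \<Rightarrow> real \<Rightarrow> real" where
  "laplace_correction \<mu> \<Sigma> \<theta> = sqrt (det (matrix_inv \<Sigma> + diag_matrix (($) (Lam_diag \<mu> \<Sigma> \<theta>)))) *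
      (LINT u|lborel. exp (- (\<Sum>i\<in>UNIV. Lam_diag \<mu> \<Sigma> \<theta> $ i * (exp (u $ i) - 1 - u $ i))
        - 1 / 2 * (u \<bullet> (matrix_inv \<Sigma> *v u)))) / sqrt ((2 * pi) ^ CARD('n))"

text \<open>
  Shift the integral to \<open>x\<^sup>*\<close>. The exponential in the approximation is \<open>exp (- h x\<^sup>*)\<close>, as stationarity
  turns \<open>1 \<bullet> D x\<^sup>*\<close> into minus the sum of the weights; and
  \<open>det (1 + \<Sigma> \<Lambda>) = det \<Sigma> * det (D + \<Lambda>)\<close>.
\<close>
lemma laplace_eq_approx_mult_correction:
  fixes \<mu> :: "real^'n"
  assumes S: "symmetric_positive_definite \<Sigma>" and \<theta>: "\<theta> > 0"
  shows "laplace \<mu> \<Sigma> \<theta> = laplace_approx \<mu> \<Sigma> \<theta> * laplace_correction \<mu> \<Sigma> \<theta>"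
    and "laplace_approx \<mu> \<Sigma> \<theta> \<noteq> 0"
proof -
  let ?D = "matrix_inv \<Sigma>" and ?x = "xstar \<mu> \<Sigma> \<theta>" and ?l = "Lam_diag \<mu> \<Sigma> \<theta>"
  let ?L = "diag_matrix (($) ?l)"
  let ?E = "\<lambda>u. exp (- (\<Sum>i\<in>UNIV. ?l $ i * (exp (u $ i) - 1 - u $ i)) - 1 / 2 * (u \<bullet> (?D *v u)))"
  have D: "symmetric_positive_definite ?D" by (rule spd_matrix_inv[OF S])
  have form: "x \<bullet> ((?D + ?L) *v y) = x \<bullet> (?D *v y) + (\<Sum>i\<in>UNIV. ?l $ i * x $ i * y $ i)" for x y
    by (simp add: matrix_vector_mult_add_rdistrib inner_add_right inner_diag_matrix)
  have DL: "symmetric_positive_definite (?D + ?L)"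
    unfolding spd_iff_form form
  proof (intro conjI allI impI)
    fix x y
    show "x \<bullet> (?D *v y) + (\<Sum>i\<in>UNIV. ?l $ i * x $ i * y $ i) = y \<bullet> (?D *v x) + (\<Sum>i\<in>UNIV. ?l $ i * y $ i * x $ i)"
      using spd_symmetric_form[OF D, of x y] by (simp add: mult_ac)
    assume "x \<noteq> 0"
    then have "x \<bullet> (?D *v x) > 0" using D by (simp add: symmetric_positive_definite_def)
    moreover have "(\<Sum>i\<in>UNIV. ?l $ i * x $ i * x $ i) \<ge> 0"
      unfolding mult.assoc
      by (intro sum_nonneg mult_nonneg_nonneg[OF less_imp_le[OF Lam_diag_pos[OF \<theta>]] zero_le_square])
    ultimately show "x \<bullet> (?D *v x) + (\<Sum>i\<in>UNIV. ?l $ i * x $ i * x $ i) > 0" by linarith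
  qed
  have pos: "det \<Sigma> > 0" "det (?D + ?L) > 0"
    using gaussian_integral(1)[OF S] gaussian_integral(1)[OF DL] by auto
  have Lam: "Lam \<mu> \<Sigma> \<theta> = ?L"
    unfolding Lam_def diag_matrix_def Lam_diag_def vec_lambda_beta ..
  have "mat 1 + \<Sigma> ** ?L = \<Sigma> ** (?D + ?L)"
    by (simp add: matrix_add_ldistrib mult_matrix_inv[OF spd_invertible[OF S]])
  then have det: "det (mat 1 + \<Sigma> ** Lam \<mu> \<Sigma> \<theta>) = det \<Sigma> * det (?D + ?L)"
    by (simp add: Lam det_mul)
  have Dx: "?D *v ?x = - ?l"
    by (simp add: vec_eq_iff Lam_diag_def xstar_stationary[OF S \<theta>])
  have expo: "(vec 1 - (1 / 2) *\<^sub>R ?x) \<bullet> (?D *v ?x) = - h \<mu> \<Sigma> \<theta> ?x"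
  proof -
    have "(vec 1 :: real^'n) \<bullet> ?l = \<theta> * (\<Sum>i\<in>UNIV. exp (\<mu> $ i + ?x $ i))"
      by (simp add: inner_vec_def Lam_diag_def sum_distrib_left)
    then show ?thesis unfolding Dx h_def by (simp add: inner_diff_left)
  qed
  have approx: "laplace_approx \<mu> \<Sigma> \<theta> = 1 / (sqrt (det \<Sigma>) * sqrt (det (?D + ?L))) * exp (- h \<mu> \<Sigma> \<theta> ?x)"
    unfolding laplace_approx_def det expo real_sqrt_mult ..
  then show "laplace_approx \<mu> \<Sigma> \<theta> \<noteq> 0" using pos by simp
  have meas: "(\<lambda>x. exp (- h \<mu> \<Sigma> \<theta> x)) \<in> borel_measurable borel"
    by (intro borel_measurable_continuous_onI continuous_intros continuous_on_h)
  have "(LINT x|lborel. exp (- \<theta> * (\<Sum>i\<in>UNIV. exp (\<mu> $ i) * exp (x $ i)) - 1 / 2 * (x \<bullet> (?D *v x))))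
      = (LINT x|lborel. exp (- h \<mu> \<Sigma> \<theta> x))"
    by (simp add: h_def exp_add)
  also have "\<dots> = (LINT x|distr lborel borel ((+) ?x). exp (- h \<mu> \<Sigma> \<theta> x))"
    by (simp only: lborel_distr_plus)
  also have "\<dots> = (LINT u|lborel. exp (- h \<mu> \<Sigma> \<theta> (?x + u)))"
    by (rule integral_distr) (use meas in measurable)
  also have "\<dots> = (LINT u|lborel. exp (- h \<mu> \<Sigma> \<theta> ?x) * ?E u)"
    unfolding h_stationary_expansion[OF S xstar_stationary[OF S \<theta>]]
    by (intro Bochner_Integration.integral_cong refl)
      (simp add: exp_add[symmetric] Lam_diag_def algebra_simps)
  also have "\<dots> = exp (- h \<mu> \<Sigma> \<theta> ?x) * (LINT u|lborel. ?E u)" by simp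
  finally have lap: "laplace \<mu> \<Sigma> \<theta> = 1 / sqrt ((2 * pi) ^ CARD('n) * det \<Sigma>) *
      (exp (- h \<mu> \<Sigma> \<theta> ?x) * (LINT u|lborel. ?E u))"
    by (simp add: laplace_def)
  show "laplace \<mu> \<Sigma> \<theta> = laplace_approx \<mu> \<Sigma> \<theta> * laplace_correction \<mu> \<Sigma> \<theta>"
    unfolding lap approx laplace_correction_def real_sqrt_mult using pos by simp
qed

section \<open>The limit of the correction factor\<close>

lemma tendsto_if_subsequences:
  fixes f :: "nat \<Rightarrow> real"
  assumes "\<And>r :: nat \<Rightarrow> nat. strict_mono r \<Longrightarrow> \<exists>s :: nat \<Rightarrow> nat. filterlim s at_top sequentially \<and> (\<lambda>k. f (r (s k))) \<longlonglongrightarrow> l"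
  shows "f \<longlonglongrightarrow> l"
proof (rule ccontr)
  assume "\<not> f \<longlonglongrightarrow> l"
  then obtain e where e: "e > 0" "\<not> eventually (\<lambda>n. dist (f n) l < e) sequentially"
    unfolding tendsto_iff by blast
  then have "infinite {n. \<not> dist (f n) l < e}"
    by (simp add: not_eventually frequently_cofinite[symmetric] cofinite_eq_sequentially)
  from infinite_enumerate[OF this] obtain r :: "nat \<Rightarrow> nat"
    where r: "strict_mono r" "\<And>n. \<not> dist (f (r n)) l < e" by auto
  from assms[OF r(1)] obtain s where s: "(\<lambda>k. f (r (s k))) \<longlonglongrightarrow> l" by blast
  have "eventually (\<lambda>k. dist (f (r (s k))) l < e) sequentially" using s e(1) by (rule tendstoD)
  then have "eventually (\<lambda>k. False) sequentially" using r(2) by simp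
  then show False by simp
qed

text \<open>
  The bounded quantities \<open>q\<^sub>i = \<lambda>\<^sub>i / (1 + \<lambda>\<^sub>i)\<close> converge along a subsequence. A limit strictly between
  \<open>0\<close> and \<open>1\<close> would make \<open>ln \<lambda>\<^sub>i\<close> bounded, which \<open>no_bounded_log_component\<close> excludes for the system
  \<open>(\<Sigma> \<lambda>)\<^sub>i + ln \<lambda>\<^sub>i = ln \<theta> + \<mu>\<^sub>i\<close>. So every weight tends to \<open>0\<close> or to \<open>\<infinity>\<close>.
\<close>
lemma laplace_correction_subsequence:
  fixes \<mu> :: "real^'n"
  assumes S: "symmetric_positive_definite \<Sigma>" and X: "filterlim X at_top sequentially"
  shows "\<exists>s :: nat \<Rightarrow> nat. filterlim s at_top sequentially \<and>
    (\<lambda>k. laplace_correction \<mu> \<Sigma> (X (s k))) \<longlonglongrightarrow> 1"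
proof -
  let ?l = "\<lambda>k. Lam_diag \<mu> \<Sigma> (X k)"
  \<comment> \<open>Discard initial terms so that the description of \<open>x\<^sup>*\<close> is available throughout.\<close>
  have "eventually (\<lambda>k. X k > 0) sequentially" using X by (simp add: filterlim_at_top_dense)
  then obtain k0 where k0: "\<And>k. k \<ge> k0 \<Longrightarrow> X k > 0" unfolding eventually_sequentially by blast
  define q where "q k = (\<chi> i. ?l (k + k0) $ i / (1 + ?l (k + k0) $ i))" for k
  have l_pos: "?l (k + k0) $ i > 0" for k i by (rule Lam_diag_pos) (simp add: k0)
  have q01: "0 < q k $ i" "q k $ i < 1" for k i
    using l_pos[of k i] by (auto simp: q_def)
  have l_q: "?l (k + k0) $ i = q k $ i / (1 - q k $ i)" for k i
    using l_pos[of k i] by (simp add: q_def field_simps)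
  have "q k \<in> cbox 0 1" for k using q01[of k] by (auto simp: mem_box_cart less_imp_le)
  then obtain \<rho> s where s: "strict_mono (s :: nat \<Rightarrow> nat)" and \<rho>: "(q \<circ> s) \<longlonglongrightarrow> \<rho>"
    using compact_cbox[of "0::real^'n" 1, unfolded compact_def, rule_format, of q] by blast
  define lam where "lam k = ?l (s k + k0)" for k
  define \<Theta> where "\<Theta> k = X (s k + k0)" for k
  have sk: "filterlim (\<lambda>k. s k + k0) at_top sequentially"
    by (rule filterlim_compose[OF filterlim_add_const_nat_at_top filterlim_subseq[OF s]])
  have \<Theta>: "filterlim \<Theta> at_top sequentially" unfolding \<Theta>_def by (rule filterlim_compose[OF X sk])
  have \<Theta>_pos: "\<Theta> k > 0" for k by (simp add: \<Theta>_def k0)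
  have qi: "(\<lambda>k. q (s k) $ i) \<longlonglongrightarrow> \<rho> $ i" for i
    using tendsto_vec_nth[OF \<rho>, of i] by (simp add: o_def)
  have lam_q: "lam k $ i = q (s k) $ i / (1 - q (s k) $ i)" for k i by (simp add: lam_def l_q)
  have lam_pos: "lam k $ i > 0" for k i unfolding lam_def by (rule l_pos)
  have lam_lim: "(\<lambda>k. lam k $ i) \<longlonglongrightarrow> \<rho> $ i / (1 - \<rho> $ i)" if "\<rho> $ i \<noteq> 1" for i
    unfolding lam_q using that by (intro tendsto_intros qi) auto
  have eqn: "(\<Sigma> *v lam k) $ i + ln (lam k $ i) - ln (\<Theta> k) = \<mu> $ i" for k i
    using Lam_diag_log_equation[OF S \<Theta>_pos, of \<mu> k i] by (simp add: lam_def \<Theta>_def)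
  have \<rho>01: "\<rho> $ i = 0" if "\<rho> $ i \<noteq> 1" for i
  proof (rule ccontr)
    assume ne: "\<rho> $ i \<noteq> 0"
    have "\<rho> $ i \<ge> 0" by (rule LIMSEQ_le_const[OF qi]) (use q01 less_imp_le in blast)
    moreover have "\<rho> $ i \<le> 1" by (rule LIMSEQ_le_const2[OF qi]) (use q01 less_imp_le in blast)
    ultimately have "\<rho> $ i / (1 - \<rho> $ i) > 0" using ne that by simp
    then have "(\<lambda>k. ln (lam k $ i)) \<longlonglongrightarrow> ln (\<rho> $ i / (1 - \<rho> $ i))"
      using lam_lim[OF that] by (intro tendsto_ln) auto
    then have "Bseq (\<lambda>k. ln (lam k $ i))" by (intro convergent_imp_Bseq) (auto simp: convergent_def)
    moreover have "\<not> Bseq (\<lambda>k. ln (lam k $ i))"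
      using no_bounded_log_component[OF S, of UNIV lam "\<lambda>k. ln (\<Theta> k)" i]
        lam_pos filterlim_compose[OF ln_at_top \<Theta>] by (simp add: eqn Bfun_const)
    ultimately show False by blast
  qed
  define P where "P = {i. \<rho> $ i = 1}"
  have zero: "(\<lambda>k. lam k $ i) \<longlonglongrightarrow> 0" if "i \<notin> P" for i
    using lam_lim[of i] \<rho>01[of i] that by (simp add: P_def)
  have inf: "filterlim (\<lambda>k. lam k $ i) at_top sequentially" if "i \<in> P" for i
  proof -
    have "(\<lambda>k. 1 - q (s k) $ i) \<longlonglongrightarrow> 1 - \<rho> $ i" by (intro tendsto_intros qi)
    then have "(\<lambda>k. 1 - q (s k) $ i) \<longlonglongrightarrow> 0" using that by (simp add: P_def)
    then have "filterlim (\<lambda>k. inverse (1 - q (s k) $ i)) at_top sequentially"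
      using q01 by (intro filterlim_inverse_at_top always_eventually allI) auto
    then have "filterlim (\<lambda>k. - 1 + inverse (1 - q (s k) $ i)) at_top sequentially"
      by (rule filterlim_tendsto_add_at_top[OF tendsto_const])
    moreover have "- 1 + inverse (1 - q (s k) $ i) = lam k $ i" for k
      unfolding lam_q using q01[of "s k" i] by (simp add: field_simps)
    ultimately show ?thesis by simp
  qed
  have "eventually (\<lambda>k. \<forall>i\<in>P. lam k $ i \<ge> 1) sequentially"
    using inf by (intro eventually_ball_finite) (auto simp: filterlim_at_top)
  then obtain k1 where k1: "\<And>k i. k \<ge> k1 \<Longrightarrow> i \<in> P \<Longrightarrow> lam k $ i \<ge> 1"
    unfolding eventually_sequentially by blast
  have k1_lim: "filterlim (\<lambda>k. k + k1) at_top sequentially" by (rule filterlim_add_const_nat_at_top)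
  have lim: "(\<lambda>k. sqrt (det (matrix_inv \<Sigma> + diag_matrix (($) (lam (k + k1))))) *
      (LINT u|lborel. exp (- (\<Sum>i\<in>UNIV. lam (k + k1) $ i * (exp (u $ i) - 1 - u $ i))
        - 1 / 2 * (u \<bullet> (matrix_inv \<Sigma> *v u))))) \<longlonglongrightarrow> sqrt ((2 * pi) ^ CARD('n))"
  proof (rule laplace_integral_tendsto[OF spd_matrix_inv[OF S], where P = P])
    show "lam (k + k1) $ i > 0" for k i by (rule lam_pos)
    show "lam (k + k1) $ i \<ge> 1" if "i \<in> P" for k i using that by (intro k1) auto
    show "filterlim (\<lambda>k. lam (k + k1) $ i) at_top sequentially" if "i \<in> P" for i
      by (rule filterlim_compose[OF inf[OF that] k1_lim])
    show "(\<lambda>k. lam (k + k1) $ i) \<longlonglongrightarrow> 0" if "i \<notin> P" for i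
      by (rule filterlim_compose[OF zero[OF that] k1_lim])
  qed
  have "(\<lambda>k. laplace_correction \<mu> \<Sigma> (X (s (k + k1) + k0))) \<longlonglongrightarrow>
      sqrt ((2 * pi) ^ CARD('n)) / sqrt ((2 * pi) ^ CARD('n))"
    unfolding laplace_correction_def lam_def[symmetric] by (intro tendsto_divide lim tendsto_const) simp
  then have "(\<lambda>k. laplace_correction \<mu> \<Sigma> (X (s (k + k1) + k0))) \<longlonglongrightarrow> 1" by simp
  moreover have "filterlim (\<lambda>k. s (k + k1) + k0) at_top sequentially"
    by (rule filterlim_compose[OF sk k1_lim])
  ultimately show ?thesis by blast
qed

theorem proposition4p1:
  fixes \<mu> :: "real ^ 'n" and \<Sigma> :: "real ^ 'n ^ 'n" and I :: "real \<Rightarrow> real"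
  assumes "symmetric_positive_definite \<Sigma>"
    and "\<And>\<theta>. \<theta> > 0 \<Longrightarrow> laplace \<mu> \<Sigma> \<theta> = laplace_approx \<mu> \<Sigma> \<theta> * I \<theta>"
  shows "(I \<longlongrightarrow> 1) at_top"
proof -
  have I: "laplace_correction \<mu> \<Sigma> \<theta> = I \<theta>" if "\<theta> > 0" for \<theta>
    using laplace_eq_approx_mult_correction[OF assms(1) that, of \<mu>] assms(2)[OF that] by simp
  have "(laplace_correction \<mu> \<Sigma> \<longlongrightarrow> 1) at_top"
  proof (rule tendsto_at_topI_sequentially, rule tendsto_if_subsequences)
    fix X :: "nat \<Rightarrow> real" and r :: "nat \<Rightarrow> nat"
    assume "filterlim X at_top sequentially" "strict_mono r"
    then have "filterlim (\<lambda>k. X (r k)) at_top sequentially"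
      using filterlim_compose filterlim_subseq by blast
    from laplace_correction_subsequence[OF assms(1) this] show "\<exists>s. filterlim s at_top sequentially \<and>
        (\<lambda>k. laplace_correction \<mu> \<Sigma> (X (r (s k)))) \<longlonglongrightarrow> 1"
      .
  qed
  moreover have "eventually (\<lambda>\<theta>. laplace_correction \<mu> \<Sigma> \<theta> = I \<theta>) at_top"
    using eventually_gt_at_top[of 0] by eventually_elim (rule I)
  ultimately show ?thesis by (rule Lim_transform_eventually)
qed

end
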